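(* Let $d\ge4$, $n\ge1$, $1\le s\le d$, $\alpha\in(0,1)$. Let $L>0$ be a constant depending only on $c_+$ such that $\exp(c_+x^2)-1\le Lx^2$ for all $0\le x\le2$. If $n\alpha^2/(d\log d)\le C/(32L)$ for some constant $C\in(0,1)$, then $$\inf_{Q\in\mathcal{Q}_\alpha}\inf_{\hat\eta\in\mathcal{T}}\sup_{\theta\in\Theta_d^+(s,a)}\mathbb{E}_{Q(P_\theta^{\otimes n})}|\hat\eta-\eta|\ \ge\ \frac14(1-C)>0$$ for all $0<a\le2\sigma$.
   Context: Model: $\sigma>0$, $\theta\in\mathbb{R}^d$; $X^1,\dots,X^n$ are i.i.d. random vectors in $\mathbb{R}^d$ with law $P_\theta$, $X^i=\theta+\sigma\xi^i$, where $\xi^i$ has i.i.d. coordinates whose common law on $\mathbb{R}$ is symmetric around $0$, has variance $1$ and is $c$-strongly log-concave for a constant $c>0$: it has density $p(x)=\exp(-\phi_0(x))\exp(-cx^2/2)$ with $\phi_0:\mathbb{R}\to\mathbb{R}$ a finite even convex function. Moreover the potential $\phi=-\log p$ has curvature bounded from above by a constant $c_+>0$: $\phi(tx+(1-t)y)-[t\phi(x)+(1-t)\phi(y)]\ge-\frac{c_+}2t(1-t)(x-y)^2$ for all $x,y\in\mathbb{R}$, $t\in(0,1)$. $\Theta_d^+(s,a)$ is the set of $\theta\in\mathbb{R}^d$ for which there is $S\subseteq\{1,\dots,d\}$ with at most $s$ elements such that $\theta_j\ge a$ for $j\in S$ and $\theta_j=0$ for $j\notin S$. Put $\eta=(I(\theta_j\ne0))_{j=1,\dots,d}$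 and $|\hat\eta-\eta|=\sum_{j=1}^d I(\hat\eta_j\neq\eta_j)$. $\mathcal{Q}_\alpha$ is the set of all non-interactive $\alpha$-locally differentially private mechanisms: sequences $Q=(Q^1,\dots,Q^n)$ of Markov kernels from $\mathbb{R}^d$ to $\mathbb{R}^d$ with $Q^i(A\mid x)\le e^\alpha Q^i(A\mid x')$ for all $i$, all measurable $A$, all $x,x'\in\mathbb{R}^d$; given the $X^i$, the $Z^i\sim Q^i(\cdot\mid X^i)$ are drawn independently, and $Q(P_\theta^{\otimes n})$ denotes the law of $(Z^1,\dots,Z^n)$. $\mathcal{T}$ is the set of separable selectors: measurable $\hat\eta=\hat\eta(Z^1,\dots,Z^n)\in\{0,1\}^d$ such that for each $j$, $\hat\eta_j$ depends only on $(Z^i_j)_{i=1,\dots,n}$. *)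

theory Defs
  imports "HOL-Probability.Probability"
begin

text \<open>
  The dimension \<open>d\<close> is the cardinality of a finite index type, so that \<open>\<real>\<^sup>d\<close> is \<open>real ^ 'd\<close>.
  A tuple \<open>(z\<^sup>1, \<dots>, z\<^sup>n)\<close> of vectors is a point of the product space indexed by \<open>{1..n}\<close>.
\<close>

definition strongly_log_concave_density :: "real \<Rightarrow> (real \<Rightarrow> real) \<Rightarrow> bool" where
  "strongly_log_concave_density c p \<longleftrightarrow>
     (\<exists>\<phi>\<^sub>0. convex_on UNIV \<phi>\<^sub>0 \<and> (\<forall>x. \<phi>\<^sub>0 (- x) = \<phi>\<^sub>0 x) \<and>
           (\<forall>x. p x = exp (- \<phi>\<^sub>0 x) * exp (- (c * x\<^sup>2 / 2))))"

definition noise_law :: "real \<Rightarrow> (real \<Rightarrow> real) \<Rightarrow> real measure \<Rightarrow> bool" where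
  "noise_law c p \<mu> \<longleftrightarrow>
     prob_space \<mu> \<and>
     \<mu> = density lborel (\<lambda>x. ennreal (p x)) \<and>
     strongly_log_concave_density c p \<and>
     distr \<mu> borel uminus = \<mu> \<and>
     prob_space.variance \<mu> (\<lambda>x. x) = 1"

definition curvature_bounded_above :: "real \<Rightarrow> (real \<Rightarrow> real) \<Rightarrow> bool" where
  "curvature_bounded_above c_plus \<phi> \<longleftrightarrow>
     (\<forall>x y. \<forall>t\<in>{0<..<1}.
        \<phi> (t * x + (1 - t) * y) - (t * \<phi> x + (1 - t) * \<phi> y) \<ge> - (c_plus / 2 * t * (1 - t) * (x - y)\<^sup>2))"

text \<open>The law of \<open>\<theta> + \<sigma> \<xi>\<close>, where the coordinates of \<open>\<xi>\<close> are i.i.d. with law \<open>\<mu>\<close>.\<close>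

definition observation_law :: "real measure \<Rightarrow> real \<Rightarrow> real ^ 'd \<Rightarrow> (real ^ 'd) measure" where
  "observation_law \<mu> \<sigma> \<theta> =
     distr (\<Pi>\<^sub>M j\<in>(UNIV :: 'd set). \<mu>) borel (\<lambda>\<xi>. \<theta> + \<sigma> *\<^sub>R vec_lambda \<xi>)"

definition sparse_signals :: "nat \<Rightarrow> real \<Rightarrow> (real ^ 'd) set" where
  "sparse_signals s a =
     {\<theta>. \<exists>S :: 'd set. card S \<le> s \<and> (\<forall>j\<in>S. \<theta> $ j \<ge> a) \<and> (\<forall>j. j \<notin> S \<longrightarrow> \<theta> $ j = 0)}"

definition support_vector :: "real ^ 'd \<Rightarrow> nat ^ 'd" where
  "support_vector \<theta> = (\<chi> j. if \<theta> $ j \<noteq> 0 then 1 else 0)"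

definition hamming_loss :: "nat ^ 'd \<Rightarrow> nat ^ 'd \<Rightarrow> nat" where
  "hamming_loss u v = (\<Sum>j\<in>UNIV. if u $ j \<noteq> v $ j then 1 else 0)"

text \<open>Only the values \<open>Q 1, \<dots>, Q n\<close> of a sequence of kernels are relevant.\<close>

definition ldp_mechanisms :: "nat \<Rightarrow> real \<Rightarrow> (nat \<Rightarrow> real ^ 'd \<Rightarrow> (real ^ 'd) measure) set" where
  "ldp_mechanisms n \<alpha> =
     {Q. \<forall>i\<in>{1..n}. Q i \<in> borel \<rightarrow>\<^sub>M prob_algebra borel \<and>
           (\<forall>A\<in>sets borel. \<forall>x x'. measure (Q i x) A \<le> exp \<alpha> * measure (Q i x') A)}"

text \<open>
  The law of \<open>(Z\<^sup>1, \<dots>, Z\<^sup>n)\<close>: draw \<open>X\<^sup>1, \<dots>, X\<^sup>n\<close> independently from \<open>P\<close> and then, given these, draw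
  \<open>Z\<^sup>i\<close> from \<open>Q i (X\<^sup>i)\<close>, independently over \<open>i\<close>.
\<close>

definition privatized_law ::
  "nat \<Rightarrow> (nat \<Rightarrow> real ^ 'd \<Rightarrow> (real ^ 'd) measure) \<Rightarrow> (real ^ 'd) measure \<Rightarrow> (nat \<Rightarrow> real ^ 'd) measure"
  where
  "privatized_law n Q P = (\<Pi>\<^sub>M i\<in>{1..n}. P) \<bind> (\<lambda>x. \<Pi>\<^sub>M i\<in>{1..n}. Q i (x i))"

text \<open>
  Measurability of the coordinates into \<open>count_space {0, 1}\<close> includes that they take values in
  \<open>{0, 1}\<close>.
\<close>

definition separable_selectors :: "nat \<Rightarrow> ((nat \<Rightarrow> real ^ 'd) \<Rightarrow> nat ^ 'd) set" where
  "separable_selectors n =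
     {\<eta>'. \<forall>j. (\<lambda>z. \<eta>' z $ j) \<in> (\<Pi>\<^sub>M i\<in>{1..n}. borel) \<rightarrow>\<^sub>M count_space {0, 1} \<and>
        (\<forall>z\<in>space (\<Pi>\<^sub>M i\<in>{1..n}. borel). \<forall>z'\<in>space (\<Pi>\<^sub>M i\<in>{1..n}. borel).
           (\<forall>i\<in>{1..n}. z i $ j = z' i $ j) \<longrightarrow> \<eta>' z $ j = \<eta>' z' $ j)}"

text \<open>
  Since the loss is nonnegative, its expectation is written as an integral in \<open>ennreal\<close>. There,
  infima and suprema always exist.
\<close>

definition selection_risk ::
  "nat \<Rightarrow> (nat \<Rightarrow> real ^ 'd \<Rightarrow> (real ^ 'd) measure) \<Rightarrow> ((nat \<Rightarrow> real ^ 'd) \<Rightarrow> nat ^ 'd) \<Rightarrow>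
     real measure \<Rightarrow> real \<Rightarrow> real ^ 'd \<Rightarrow> ennreal" where
  "selection_risk n Q \<eta>' \<mu> \<sigma> \<theta> =
     (\<integral>\<^sup>+ z. of_nat (hamming_loss (\<eta>' z) (support_vector \<theta>))
        \<partial>(privatized_law n Q (observation_law \<mu> \<sigma> \<theta>)))"

end

theory Submission
  imports Defs
begin

text \<open>
  Compare the signals \<open>0\<close> and \<open>a e\<^sub>j\<close>, all of which are admissible. Let \<open>N\<close> be the law of an
  observation under \<open>0\<close> and \<open>1 + l\<^sub>j\<close> the density with respect to \<open>N\<close> of its law under \<open>a e\<^sub>j\<close>. The
  \<open>l\<^sub>j\<close> are orthogonal in \<open>L\<^sup>2(N)\<close>, and the curvature bound gives
  \<open>\<parallel>l\<^sub>j\<parallel>\<^sup>2 \<le> exp (c\<^sub>+ a\<^sup>2 / \<sigma>\<^sup>2) - 1 \<le> 4 L\<close>. A private channel sees \<open>l\<^sub>j\<close> only through functions of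
  oscillation \<open>exp \<alpha> - 1 \<le> 2 \<alpha>\<close>, so by a Bessel-type inequality the chi-square divergences of its
  outputs, summed over all \<open>j\<close>, are at most \<open>4 \<alpha>\<^sup>2 \<cdot> 4 L\<close>. Without orthogonality the bound would be
  larger by a factor \<open>d\<close>. Write \<open>y\<^sub>j\<close> for the sum over the \<open>n\<close> samples, so that
  \<open>\<Sum>\<^sub>j y\<^sub>j \<le> 16 n L \<alpha>\<^sup>2 \<le> d log d\<close>. By Cauchy--Schwarz, if the event that \<open>j\<close> is selected has
  probability \<open>x\<^sub>j\<close> under \<open>0\<close>, then it has probability at most \<open>sqrt (x\<^sub>j exp y\<^sub>j)\<close> under \<open>a e\<^sub>j\<close>. If
  all risks were below \<open>1/4\<close>, then \<open>x\<^sub>j exp y\<^sub>j \<ge> 9/16\<close> for all \<open>j\<close>, and by convexity of \<open>exp\<close> the risk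
  \<open>\<Sum>\<^sub>j x\<^sub>j\<close> under \<open>0\<close>
  would be at least \<open>9/16\<close>.
\<close>

section \<open>Kernels with bounded likelihood ratios\<close>

lemma integral_le_scaled:
  fixes F :: "'a \<Rightarrow> real"
  assumes "sets Q = sets M" and le: "\<And>A. A \<in> sets M \<Longrightarrow> emeasure Q A \<le> ennreal k * emeasure M A"
    and "k \<ge> 0" and F: "integrable M F" "integrable Q F" "\<And>x. F x \<ge> 0"
  shows "integral\<^sup>L Q F \<le> k * integral\<^sup>L M F"
proof -
  have meas: "F \<in> borel_measurable M" using F(1) by auto
  \<comment> \<open>Phrased as an inequality between measures, the setwise bound passes to
    nonnegative integrands by monotonicity of the integral in the measure.\<close>
  have "Q \<le> scale_measure k M"
    using le sets_eq_imp_space_eq[OF assms(1)] sets_eq_imp_space_eq[OF sets_scale_measure[of k M]]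
    by (simp add: le_measure_iff le_fun_def assms(1)) (metis assms(1) emeasure_notin_sets zero_le)
  then have "(\<integral>\<^sup>+x. F x \<partial>Q) \<le> (\<integral>\<^sup>+x. F x \<partial>scale_measure k M)"
    by (intro nn_integral_mono_measure) (simp_all add: assms(1))
  also have "\<dots> = ennreal k * (\<integral>\<^sup>+x. F x \<partial>M)"
    using meas by (intro nn_integral_scale_measure) auto
  finally have "ennreal (integral\<^sup>L Q F) \<le> ennreal (k * integral\<^sup>L M F)"
    using F assms(3) by (simp add: nn_integral_eq_integral ennreal_mult integral_nonneg_AE)
  then show ?thesis
    using F assms(3) by (simp add: ennreal_le_iff integral_nonneg_AE)
qed

text \<open>The positive part of \<open>F\<close> is controlled by \<open>Q\<close> being at most
  \<open>k\<close> times \<open>M\<close>, the negative part by the reverse domination. Only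
  \<open>M\<close> appears on the right, so that one reference measure can later serve all laws
  \<open>K x\<close> at once.\<close>

lemma integral_diff_le_multiplicative:
  fixes F :: "'a \<Rightarrow> real"
  assumes s: "sets Q = sets M" and "k \<ge> 1"
    and le: "\<And>A. A \<in> sets M \<Longrightarrow> emeasure Q A \<le> ennreal k * emeasure M A"
      "\<And>A. A \<in> sets M \<Longrightarrow> emeasure M A \<le> ennreal k * emeasure Q A"
    and F: "integrable M F" "integrable Q F"
  shows "integral\<^sup>L Q F - integral\<^sup>L M F \<le> (k - 1) * (\<integral>x. \<bar>F x\<bar> \<partial>M)"
proof -
  let ?p = "\<lambda>x. max (F x) 0" and ?n = "\<lambda>x. max (- F x) 0"
  have i[simp]: "integrable M ?p" "integrable Q ?p" "integrable M ?n" "integrable Q ?n"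
    using F by auto
  have eq: "F = (\<lambda>x. ?p x - ?n x)" by (auto simp: fun_eq_iff max_def)
  have eq': "(\<lambda>x. \<bar>F x\<bar>) = (\<lambda>x. ?p x + ?n x)" by (auto simp: fun_eq_iff max_def)
  have 1: "integral\<^sup>L Q ?p \<le> k * integral\<^sup>L M ?p"
    using assms by (intro integral_le_scaled) auto
  have 2: "integral\<^sup>L M ?n \<le> k * integral\<^sup>L Q ?n"
    using assms by (intro integral_le_scaled) auto
  have 3: "integral\<^sup>L M ?n - integral\<^sup>L Q ?n \<le> (k - 1) * integral\<^sup>L M ?n"
  \<comment> \<open>By fact 2 the difference is at most \<open>k - 1\<close> times the integral
    under \<open>Q\<close>. That integral may be replaced by the one under \<open>M\<close> if it is
    the smaller of the two; otherwise the left side is negative.\<close>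
  proof (cases "integral\<^sup>L Q ?n \<le> integral\<^sup>L M ?n")
    case True
    then have "(k - 1) * integral\<^sup>L Q ?n \<le> (k - 1) * integral\<^sup>L M ?n"
      using \<open>k \<ge> 1\<close> by (intro mult_left_mono) auto
    with 2 show ?thesis by (simp add: algebra_simps)
  next
    case False
    moreover have "0 \<le> (k - 1) * integral\<^sup>L M ?n" using \<open>k \<ge> 1\<close> by (auto intro!: mult_nonneg_nonneg Bochner_Integration.integral_nonneg)
    ultimately show ?thesis by simp
  qed
  have "integral\<^sup>L Q F = integral\<^sup>L Q ?p - integral\<^sup>L Q ?n"
    by (subst eq, subst Bochner_Integration.integral_diff) auto
  moreover have "integral\<^sup>L M F = integral\<^sup>L M ?p - integral\<^sup>L M ?n"
    by (subst eq, subst Bochner_Integration.integral_diff) auto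
  moreover have "(\<integral>x. \<bar>F x\<bar> \<partial>M) = integral\<^sup>L M ?p + integral\<^sup>L M ?n"
    by (subst eq', subst Bochner_Integration.integral_add) auto
  ultimately show ?thesis using 1 3 by (simp add: algebra_simps)
qed

text \<open>A ratio bound between any two inputs survives averaging over either of them with the
  same constant, because the input laws have mass one.\<close>

lemma bind_emeasure_le:
  assumes K: "K \<in> X \<rightarrow>\<^sub>M prob_algebra Z"
    and ldp: "\<And>A x x'. A \<in> sets Z \<Longrightarrow> x \<in> space X \<Longrightarrow> x' \<in> space X \<Longrightarrow>
      emeasure (K x) A \<le> ennreal k * emeasure (K x') A"
    and N: "N \<in> space (prob_algebra X)" and N': "N' \<in> space (prob_algebra X)"
    and A: "A \<in> sets Z"
  shows "\<And>x. x \<in> space X \<Longrightarrow> emeasure (N \<bind> K) A \<le> ennreal k * emeasure (K x) A"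
    and "\<And>x. x \<in> space X \<Longrightarrow> emeasure (K x) A \<le> ennreal k * emeasure (N \<bind> K) A"
    and "emeasure (N \<bind> K) A \<le> ennreal k * emeasure (N' \<bind> K) A"
proof -
  have sp: "space N = space X" "space N' = space X" "emeasure N (space X) = 1" "emeasure N' (space X) = 1"
    using N N' by (auto simp: space_prob_algebra dest: sets_eq_imp_space_eq intro!: in_space_prob_algebra)
  note eb = emeasure_bind_prob_algebra[OF _ K A]
  have mN: "(\<lambda>x. emeasure (K x) A) \<in> borel_measurable N" "(\<lambda>x. emeasure (K x) A) \<in> borel_measurable N'"
    using measurable_prob_algebraD[OF K] A N N'
    by (auto simp: space_prob_algebra measurable_cong_sets[of N X] measurable_cong_sets[of N' X]
      intro: measurable_emeasure_kernel)
  show 1: "emeasure (N \<bind> K) A \<le> ennreal k * emeasure (K x) A" if "x \<in> space X" for x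
  proof -
    have "(\<integral>\<^sup>+y. emeasure (K y) A \<partial>N) \<le> (\<integral>\<^sup>+y. ennreal k * emeasure (K x) A \<partial>N)"
      by (intro nn_integral_mono ldp) (auto simp: that A sp)
    then show ?thesis by (simp add: eb[OF N] sp)
  qed
  show 2: "emeasure (K x) A \<le> ennreal k * emeasure (N \<bind> K) A" if "x \<in> space X" for x
  proof -
    have "(\<integral>\<^sup>+y. emeasure (K x) A \<partial>N) \<le> (\<integral>\<^sup>+y. ennreal k * emeasure (K y) A \<partial>N)"
      by (intro nn_integral_mono ldp) (auto simp: that A sp)
    then show ?thesis using mN by (simp add: eb[OF N] sp nn_integral_cmult)
  qed
  have "(\<integral>\<^sup>+y. emeasure (N \<bind> K) A \<partial>N') \<le> (\<integral>\<^sup>+y. ennreal k * emeasure (K y) A \<partial>N')"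
    by (intro nn_integral_mono 1) (auto simp: A sp)
  then show "emeasure (N \<bind> K) A \<le> ennreal k * emeasure (N' \<bind> K) A"
    using mN by (simp add: eb[OF N'] sp nn_integral_cmult)
qed

text \<open>Domination implies absolute continuity, and the Radon--Nikodym derivative is then at
  most \<open>k\<close> almost everywhere. Truncation makes the bound hold at every point, so that
  it is available under other measures too.\<close>

lemma bounded_density_exists:
  assumes M: "prob_space M" and s: "sets Q = sets M" and "k \<ge> 0"
    and le: "\<And>A. A \<in> sets M \<Longrightarrow> emeasure Q A \<le> ennreal k * emeasure M A"
  obtains f where "f \<in> borel_measurable M" "\<And>x. 0 \<le> f x" "\<And>x. f x \<le> k" "Q = density M (\<lambda>x. ennreal (f x))"
proof -
  interpret prob_space M by fact
  have "absolutely_continuous M Q"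
    unfolding absolutely_continuous_def
  proof
    fix A assume "A \<in> null_sets M"
    then show "A \<in> null_sets Q" using le[of A] by (auto simp: null_sets_def s)
  qed
  then obtain g where g[measurable]: "g \<in> borel_measurable M" and Q: "density M g = Q"
    using Radon_Nikodym[of Q] s by auto
  \<comment> \<open>On \<open>A\<close> the derivative exceeds \<open>k\<close>. The excess
    integrates to the mass of \<open>A\<close> under \<open>Q\<close> minus \<open>k\<close> times
    its mass under \<open>M\<close>, which is zero because subtraction in \<open>ennreal\<close> is
    truncated.\<close>
  define A where "A = {x\<in>space M. g x > ennreal k}"
  have [measurable]: "A \<in> sets M" unfolding A_def by measurable
  have "(\<integral>\<^sup>+x. (g x - ennreal k) * indicator A x \<partial>M) = (\<integral>\<^sup>+x. g x * indicator A x - ennreal k * indicator A x \<partial>M)"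
    by (intro nn_integral_cong) (auto simp: indicator_def)
  also have "\<dots> = (\<integral>\<^sup>+x. g x * indicator A x \<partial>M) - (\<integral>\<^sup>+x. ennreal k * indicator A x \<partial>M)"
  proof (intro nn_integral_diff)
    show "(\<integral>\<^sup>+x. ennreal k * indicator A x \<partial>M) \<noteq> \<infinity>"
      by (simp add: nn_integral_cmult ennreal_mult_eq_top_iff)
    show "AE x in M. ennreal k * indicator A x \<le> g x * indicator A x"
      by (auto simp: A_def indicator_def)
  qed auto
  also have "\<dots> = emeasure Q A - ennreal k * emeasure M A"
    by (simp add: Q[symmetric] emeasure_density nn_integral_cmult)
  also have "\<dots> = 0"
    using le[of A]
    by (auto simp: diff_eq_0_iff_ennreal emeasure_eq_measure ennreal_mult_less_top intro: le_less_trans)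
  finally have "AE x in M. (g x - ennreal k) * indicator A x = 0"
    by (subst (asm) nn_integral_0_iff_AE) auto
  with AE_space have "AE x in M. g x \<le> ennreal k"
    by eventually_elim (auto simp: A_def indicator_def diff_eq_0_iff_ennreal not_less split: if_splits)
  then have "density M g = density M (\<lambda>x. ennreal (enn2real (min (g x) (ennreal k))))"
    by (intro density_cong) (auto elim!: eventually_mono simp: ennreal_enn2real_if min_absorb1 top_unique)
  then show ?thesis
    using Q \<open>k \<ge> 0\<close> by (intro that[of "\<lambda>x. enn2real (min (g x) (ennreal k))"])
      (auto intro!: enn2real_leI)
qed

text \<open>Let \<open>g j = f j - 1\<close> and let \<open>S\<close> be the sum of the squared
  norms of the \<open>g j\<close> under the output law \<open>M\<close>. Each squared norm is the
  mean over \<open>x\<close> of \<open>l j x\<close> times the integral of \<open>g j\<close>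
  against \<open>K x\<close> minus \<open>M\<close>. For fixed \<open>x\<close> the sum over
  \<open>j\<close> tests this difference on a single function, so the ratio bound and the
  arithmetic-geometric mean inequality apply once. Averaging over \<open>x\<close>, orthogonality
  leaves only diagonal terms, at most \<open>v * S\<close> in total. Hence \<open>S\<close> is at
  most half of \<open>(k - 1)\<^sup>2 * v + S\<close>, and \<open>S\<close> is absorbed on the
  left.\<close>

lemma private_kernel_chi_square_sum:
  fixes K :: "'x \<Rightarrow> 'z measure" and l :: "'j::finite \<Rightarrow> 'x \<Rightarrow> real"
  assumes K: "K \<in> X \<rightarrow>\<^sub>M prob_algebra Z" and k: "k \<ge> 1"
    and ldp: "\<And>A x x'. A \<in> sets Z \<Longrightarrow> x \<in> space X \<Longrightarrow> x' \<in> space X \<Longrightarrow>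
      emeasure (K x) A \<le> ennreal k * emeasure (K x') A"
    and N: "N \<in> space (prob_algebra X)"
    and l[measurable]: "\<And>j. l j \<in> borel_measurable X"
    and l_ge: "\<And>j x. x \<in> space X \<Longrightarrow> 0 \<le> 1 + l j x"
    and prob: "\<And>j. prob_space (density N (\<lambda>x. ennreal (1 + l j x)))"
    and sq: "\<And>j. integrable N (\<lambda>x. (l j x)\<^sup>2)"
    and orth: "\<And>i j. i \<noteq> j \<Longrightarrow> (\<integral>x. l i x * l j x \<partial>N) = 0"
    and v: "\<And>j. (\<integral>x. (l j x)\<^sup>2 \<partial>N) \<le> v" "v > 0"
  obtains f where "\<And>j. f j \<in> borel_measurable Z" "\<And>j z. 0 \<le> f j z" "\<And>j z. f j z \<le> k"
    "\<And>j. density N (\<lambda>x. ennreal (1 + l j x)) \<bind> K = density (N \<bind> K) (\<lambda>z. ennreal (f j z))"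
    "(\<Sum>j\<in>UNIV. \<integral>z. (f j z - 1)\<^sup>2 \<partial>(N \<bind> K)) \<le> (k - 1)\<^sup>2 * v"
proof -
  define M where "M = N \<bind> K"
  define N' where "N' j = density N (\<lambda>x. ennreal (1 + l j x))" for j
  have sN: "sets N = sets X" "space N = space X" and pN: "prob_space N"
    using N by (auto simp: space_prob_algebra dest: sets_eq_imp_space_eq)
  interpret N: prob_space N by fact
  have [measurable_cong]: "sets N = sets X" by fact
  have N'sp: "N' j \<in> space (prob_algebra X)" for j
    using prob[of j] sN by (simp add: space_prob_algebra N'_def)
  have M: "prob_space M" and sM[measurable_cong]: "sets M = sets Z"
    unfolding M_def using prob_space_bind'[OF N K] sets_bind'[OF N K] by auto
  interpret M: prob_space M by fact
  have Kx: "prob_space (K x)" "sets (K x) = sets Z" if "x \<in> space X" for x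
    using measurable_space[OF K that] by (auto simp: space_prob_algebra)
  have "\<exists>f. f \<in> borel_measurable M \<and> (\<forall>z. 0 \<le> f z) \<and> (\<forall>z. f z \<le> k) \<and>
      N' j \<bind> K = density M (\<lambda>z. ennreal (f z))" for j
  proof -
    have s: "sets (N' j \<bind> K) = sets M" using sets_bind'[OF N'sp K] sM by simp
    have le: "emeasure (N' j \<bind> K) A \<le> ennreal k * emeasure M A" if "A \<in> sets M" for A
      unfolding M_def using that sM by (intro bind_emeasure_le(3)[OF K ldp N'sp N]) auto
    have "k \<ge> 0" using k by simp
    from bounded_density_exists[OF M s this le] obtain f where "f \<in> borel_measurable M" "\<And>x. 0 \<le> f x" "\<And>x. f x \<le> k"
      "N' j \<bind> K = density M (\<lambda>x. ennreal (f x))"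
      by blast
    then show ?thesis by blast
  qed
  then have "\<forall>j. \<exists>f. f \<in> borel_measurable M \<and> (\<forall>z. 0 \<le> f z) \<and> (\<forall>z. f z \<le> k) \<and>
      N' j \<bind> K = density M (\<lambda>z. ennreal (f z))" by blast
  from choice[OF this] obtain f where f': "\<And>j. f j \<in> borel_measurable M" and f0: "\<And>j z. 0 \<le> f j z"
    and fk: "\<And>j z. f j z \<le> k" and fd: "\<And>j. N' j \<bind> K = density M (\<lambda>z. ennreal (f j z))"
    by blast
  have f[measurable]: "f j \<in> borel_measurable Z" for j
    using f'[of j] by (simp cong: measurable_cong_sets add: sM)
  define g where "g j z = f j z - 1" for j z
  have gb: "\<bar>g j z\<bar> \<le> k" for j z using f0[of j z] fk[of j z] k by (auto simp: g_def)
  have g[measurable]: "g j \<in> borel_measurable Z" for j unfolding g_def by measurable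
  have ggb: "\<bar>g i z * g j z\<bar> \<le> k * k" for i j z
    unfolding abs_mult using gb k by (intro mult_mono) auto
  have int_bounded: "integrable P h"
    if "prob_space P" "sets P = sets Z" "h \<in> borel_measurable Z" "\<And>z. \<bar>h z\<bar> \<le> B" for P and h :: "'z \<Rightarrow> real" and B
  proof -
    interpret P: prob_space P by fact
    have "h \<in> borel_measurable P" using that by (simp cong: measurable_cong_sets)
    then show ?thesis using that by (intro P.integrable_const_bound[of _ B]) auto
  qed
  have igM: "integrable M (g j)" for j by (rule int_bounded[OF M sM g gb])
  have igK: "integrable (K x) (g j)" if "x \<in> space X" for x j by (rule int_bounded[OF Kx[OF that] g gb])
  have iggM: "integrable M (\<lambda>z. g i z * g j z)" for i j by (rule int_bounded[OF M sM _ ggb]) measurable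
  define h where "h j x = (\<integral>z. g j z \<partial>K x)" for j x
  define m where "m j = (\<integral>z. g j z \<partial>M)" for j
  have Ksub: "K \<in> X \<rightarrow>\<^sub>M subprob_algebra Z" using K by (rule measurable_prob_algebraD)
  have h[measurable]: "h j \<in> borel_measurable X" for j
    unfolding h_def using Ksub by (rule measurable_compose) measurable
  have hb: "\<bar>h j x\<bar> \<le> k" if "x \<in> space X" for j x
  proof -
    interpret P: prob_space "K x" by (rule Kx[OF that])
    have "\<bar>h j x\<bar> \<le> (\<integral>z. \<bar>g j z\<bar> \<partial>K x)" unfolding h_def by (rule integral_abs_bound)
    also have "\<dots> \<le> (\<integral>z. k \<partial>K x)" using igK[OF that] gb by (intro integral_mono) auto
    finally show ?thesis by (simp add: P.prob_space)
  qed
  have il: "integrable N (l j)" for j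
    using sq[of j] by (rule N.square_integrable_imp_integrable[rotated]) measurable
  have ill: "integrable N (\<lambda>x. l i x * l j x)" for i j
  proof (rule Bochner_Integration.integrable_bound)
    show "integrable N (\<lambda>x. (l i x)\<^sup>2 + (l j x)\<^sup>2)" using sq by auto
    show "AE x in N. norm (l i x * l j x) \<le> norm ((l i x)\<^sup>2 + (l j x)\<^sup>2)"
    proof (rule AE_I2)
      fix x
      have "2 * (\<bar>l i x\<bar> * \<bar>l j x\<bar>) \<le> (l i x)\<^sup>2 + (l j x)\<^sup>2"
        using sum_squares_bound[of "\<bar>l i x\<bar>" "\<bar>l j x\<bar>"] by (simp add: mult.assoc)
      moreover have "0 \<le> \<bar>l i x\<bar> * \<bar>l j x\<bar>" by simp
      ultimately have "\<bar>l i x\<bar> * \<bar>l j x\<bar> \<le> (l i x)\<^sup>2 + (l j x)\<^sup>2" by linarith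
      then show "norm (l i x * l j x) \<le> norm ((l i x)\<^sup>2 + (l j x)\<^sup>2)" by (simp add: abs_mult)
    qed
  qed measurable
  have l0: "(\<integral>x. l j x \<partial>N) = 0" for j
  proof -
    interpret P: prob_space "N' j" unfolding N'_def by (rule prob)
    have "1 = (\<integral>x. (1::real) \<partial>N' j)" by (simp add: P.prob_space)
    also have "\<dots> = (\<integral>x. 1 + l j x \<partial>N)"
      unfolding N'_def using l_ge sN by (subst integral_density) auto
    also have "\<dots> = 1 + (\<integral>x. l j x \<partial>N)" using il by (simp add: N.prob_space)
    finally show ?thesis by simp
  qed
  have ilh: "integrable N (\<lambda>x. l j x * h j x)" for j
  proof (rule Bochner_Integration.integrable_bound)
    show "integrable N (\<lambda>x. k * l j x)" using il by auto
    show "AE x in N. norm (l j x * h j x) \<le> norm (k * l j x)"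
      using hb k sN by (auto simp: abs_mult mult.commute intro!: mult_mono)
  qed measurable
  txt \<open>\<open>g j\<close> is tested against the kernel centred at \<open>M\<close>, so that the likelihood ratio bound applies
    for each \<open>x\<close> separately and no jointly measurable density of the kernel is needed.\<close>
  have sj: "(\<integral>z. (g j z)\<^sup>2 \<partial>M) = (\<integral>x. l j x * (h j x - m j) \<partial>N)" for j
  proof -
    have "(\<integral>z. (g j z)\<^sup>2 \<partial>M) = (\<integral>z. f j z * g j z - g j z \<partial>M)"
      by (intro Bochner_Integration.integral_cong) (auto simp: g_def power2_eq_square algebra_simps)
    also have "\<dots> = (\<integral>z. f j z * g j z \<partial>M) - m j"
    proof -
      have "integrable M (\<lambda>z. f j z * g j z)"
        using Bochner_Integration.integrable_add[OF iggM[of j j] igM[of j]]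
        by (simp add: g_def algebra_simps)
      then show ?thesis using igM by (simp add: m_def)
    qed
    also have "(\<integral>z. f j z * g j z \<partial>M) = (\<integral>z. g j z \<partial>(N' j \<bind> K))"
      unfolding fd using f0 by (subst integral_density) auto
    also have "\<dots> = (\<integral>x. h j x \<partial>N' j)"
    proof -
      interpret P: prob_space "N' j" unfolding N'_def by (rule prob)
      show ?thesis unfolding h_def
      proof (rule integral_bind[where B=k and B'=1 and K=Z])
        show "K \<in> N' j \<rightarrow>\<^sub>M subprob_algebra Z" using Ksub unfolding N'_def by measurable
        show "AE x in N' j. emeasure (K x) (space (K x)) \<le> ennreal 1"
          using Kx(1) sN by (intro AE_I2) (auto simp: N'_def prob_space.emeasure_space_1)
      qed (auto simp: gb P.finite_measure_axioms)
    qed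
    also have "\<dots> = (\<integral>x. (1 + l j x) * h j x \<partial>N)"
      unfolding N'_def using l_ge sN by (subst integral_density) auto
    also have "\<dots> = (\<integral>x. h j x \<partial>N) + (\<integral>x. l j x * h j x \<partial>N)"
    proof -
      have "integrable N (h j)" using hb sN by (intro N.integrable_const_bound[of _ k]) auto
      then show ?thesis using ilh by (simp add: distrib_right)
    qed
    also have "(\<integral>x. h j x \<partial>N) = m j"
      unfolding h_def m_def M_def
    proof (rule integral_bind[where B=k and B'=1 and K=Z, symmetric])
      show "K \<in> N \<rightarrow>\<^sub>M subprob_algebra Z" using Ksub by measurable
      show "AE x in N. emeasure (K x) (space (K x)) \<le> ennreal 1"
        using Kx(1) sN by (intro AE_I2) (auto simp: prob_space.emeasure_space_1)
    qed (auto simp: gb N.finite_measure_axioms)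
    \<comment> \<open>Since \<open>l j\<close> has mean zero under \<open>N\<close>, the constant
      \<open>m j\<close> can be subtracted inside the integral.\<close>
    also have "m j + (\<integral>x. l j x * h j x \<partial>N) - m j = (\<integral>x. l j x * (h j x - m j) \<partial>N)"
      using il ilh l0 by (simp add: right_diff_distrib)
    finally show ?thesis .
  qed
  \<comment> \<open>The Gram matrix of the \<open>g j\<close> in the square-integrable functions of
    \<open>M\<close>; its trace is \<open>S\<close>.\<close>
  define G where "G i j = (\<integral>z. g i z * g j z \<partial>M)" for i j
  define S where "S = (\<Sum>j\<in>UNIV. \<integral>z. (g j z)\<^sup>2 \<partial>M)"
  define b where "b = k - 1"
  have ilG: "integrable N (\<lambda>x. \<Sum>i\<in>UNIV. \<Sum>j\<in>UNIV. l i x * l j x * G i j)"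
    by (intro Bochner_Integration.integrable_sum integrable_mult_left ill)
  have "S = (\<integral>x. (\<Sum>j\<in>UNIV. l j x * (h j x - m j)) \<partial>N)"
    unfolding S_def sj using il ilh
    by (subst Bochner_Integration.integral_sum) (auto simp: right_diff_distrib)
  also have "\<dots> \<le> (\<integral>x. (b\<^sup>2 * v + (\<Sum>i\<in>UNIV. \<Sum>j\<in>UNIV. l i x * l j x * G i j) / v) / 2 \<partial>N)"
  proof (rule integral_mono)
    show "integrable N (\<lambda>x. \<Sum>j\<in>UNIV. l j x * (h j x - m j))"
      using il ilh by (auto simp: right_diff_distrib)
    show "integrable N (\<lambda>x. (b\<^sup>2 * v + (\<Sum>i\<in>UNIV. \<Sum>j\<in>UNIV. l i x * l j x * G i j) / v) / 2)"
      using ilG by auto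
    fix x assume "x \<in> space N"
    then have x: "x \<in> space X" by (simp add: sN)
    \<comment> \<open>All \<open>j\<close> are combined into one test function before the ratio
      bound is used; this keeps the products \<open>l i x * l j x\<close> on which orthogonality
      acts.\<close>
    let ?F = "\<lambda>z. \<Sum>j\<in>UNIV. l j x * g j z"
    have iF: "integrable M ?F" "integrable (K x) ?F" using igM igK[OF x] by auto
    have F2: "(\<lambda>z. (?F z)\<^sup>2) = (\<lambda>z. \<Sum>i\<in>UNIV. \<Sum>j\<in>UNIV. (l i x * l j x) * (g i z * g j z))"
      unfolding power2_eq_square sum_product by (intro ext sum.cong refl) simp
    have iF2: "integrable M (\<lambda>z. (?F z)\<^sup>2)"
      unfolding F2 using iggM by simp
    have "(\<Sum>j\<in>UNIV. l j x * (h j x - m j)) = integral\<^sup>L (K x) ?F - integral\<^sup>L M ?F"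
      using igM igK[OF x] by (simp add: h_def m_def right_diff_distrib sum_subtractf)
    also have "\<dots> \<le> b * (\<integral>z. \<bar>?F z\<bar> \<partial>M)"
      unfolding b_def
      using bind_emeasure_le(1,2)[OF K ldp N N _ x] sM Kx[OF x]
      by (intro integral_diff_le_multiplicative iF k) (auto simp: M_def)
    also have "\<dots> = (\<integral>z. b * \<bar>?F z\<bar> \<partial>M)" by simp
    also have "\<dots> \<le> (\<integral>z. (b\<^sup>2 * v + (?F z)\<^sup>2 / v) / 2 \<partial>M)"
    proof (rule integral_mono)
      show "integrable M (\<lambda>z. b * \<bar>?F z\<bar>)" using iF by auto
      show "integrable M (\<lambda>z. (b\<^sup>2 * v + (?F z)\<^sup>2 / v) / 2)" using iF2 by auto
      fix z
      \<comment> \<open>The weight \<open>v\<close> is chosen so that, after orthogonality, the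
        quadratic term contributes at most \<open>S / 2\<close>.\<close>
      have "2 * (b * v) * \<bar>?F z\<bar> \<le> (b * v)\<^sup>2 + \<bar>?F z\<bar>\<^sup>2" by (rule sum_squares_bound)
      then show "b * \<bar>?F z\<bar> \<le> (b\<^sup>2 * v + (?F z)\<^sup>2 / v) / 2"
        using v(2) by (simp add: field_simps power2_eq_square)
    qed
    also have "\<dots> = (b\<^sup>2 * v + (\<integral>z. (?F z)\<^sup>2 \<partial>M) / v) / 2"
      using iF2 by (simp add: M.prob_space)
    also have "(\<integral>z. (?F z)\<^sup>2 \<partial>M) = (\<Sum>i\<in>UNIV. \<Sum>j\<in>UNIV. l i x * l j x * G i j)"
      unfolding F2 G_def using iggM by simp
    finally show "(\<Sum>j\<in>UNIV. l j x * (h j x - m j)) \<le>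
      (b\<^sup>2 * v + (\<Sum>i\<in>UNIV. \<Sum>j\<in>UNIV. l i x * l j x * G i j) / v) / 2" .
  qed
  also have "\<dots> = (b\<^sup>2 * v + (\<integral>x. (\<Sum>i\<in>UNIV. \<Sum>j\<in>UNIV. l i x * l j x * G i j) \<partial>N) / v) / 2"
    using ilG by (simp add: N.prob_space)
  also have "(\<integral>x. (\<Sum>i\<in>UNIV. \<Sum>j\<in>UNIV. l i x * l j x * G i j) \<partial>N) = 
      (\<Sum>i\<in>UNIV. \<Sum>j\<in>UNIV. (\<integral>x. l i x * l j x \<partial>N) * G i j)"
    using ill by simp
  also have "\<dots> = (\<Sum>i\<in>UNIV. (\<integral>x. (l i x)\<^sup>2 \<partial>N) * G i i)"
  proof (intro sum.cong refl)
    fix i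
    have "(\<Sum>j\<in>UNIV. (\<integral>x. l i x * l j x \<partial>N) * G i j) = (\<Sum>j\<in>UNIV. if j = i then (\<integral>x. l i x * l i x \<partial>N) * G i i else 0)"
      by (intro sum.cong) (auto simp: orth)
    then show "(\<Sum>j\<in>UNIV. (\<integral>x. l i x * l j x \<partial>N) * G i j) = (\<integral>x. (l i x)\<^sup>2 \<partial>N) * G i i"
      by (simp add: power2_eq_square)
  qed
  finally have S: "S \<le> (b\<^sup>2 * v + (\<Sum>i\<in>UNIV. (\<integral>x. (l i x)\<^sup>2 \<partial>N) * G i i) / v) / 2" .
  moreover have "(\<Sum>i\<in>UNIV. (\<integral>x. (l i x)\<^sup>2 \<partial>N) * G i i) \<le> (\<Sum>i\<in>UNIV. v * G i i)"
    using v(1) by (intro sum_mono mult_right_mono) (auto simp: G_def)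
  moreover have "(\<Sum>i\<in>UNIV. v * G i i) = v * S"
    by (simp add: S_def G_def sum_distrib_left power2_eq_square)
  ultimately have "(\<Sum>i\<in>UNIV. (\<integral>x. (l i x)\<^sup>2 \<partial>N) * G i i) / v \<le> S"
    using v(2) by (simp add: divide_le_eq mult.commute)
  with S have "S \<le> (b\<^sup>2 * v + S) / 2" by simp
  then have "S \<le> b\<^sup>2 * v" using v(2) by simp
  then show ?thesis
    using f f0 fk fd by (intro that[of f]) (auto simp: S_def b_def g_def M_def N'_def)
qed

section \<open>Product measures\<close>

lemma prob_kernel_borel:
  fixes K :: "'a::topological_space \<Rightarrow> 'b::topological_space measure"
  assumes "K \<in> borel \<rightarrow>\<^sub>M prob_algebra borel"
  shows "prob_space (K x)" "sets (K x) = sets borel"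
  using measurable_space[OF assms, of x] by (auto simp: space_prob_algebra)

lemma emeasure_PiM_prob:
  assumes "\<And>i. prob_space (M i)" "finite I" "\<And>i. i \<in> I \<Longrightarrow> A i \<in> sets (M i)"
  shows "emeasure (PiM I M) (Pi\<^sub>E I A) = (\<Prod>i\<in>I. emeasure (M i) (A i))"
proof -
  interpret product_prob_space M I using assms by (intro product_prob_spaceI)
  show ?thesis using assms by (intro emeasure_PiM)
qed

text \<open>Rectangles generate the product sigma-algebra and are stable under intersection.
  Measurability is thus only checked there, where the mass is a finite product.\<close>

lemma PiM_kernel_measurable:
  fixes K :: "'i \<Rightarrow> 'a::topological_space \<Rightarrow> 'b::topological_space measure"
  assumes I: "finite I" and K: "\<And>i. K i \<in> borel \<rightarrow>\<^sub>M prob_algebra borel"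
  shows "(\<lambda>x. \<Pi>\<^sub>M i\<in>I. K i (x i)) \<in> (\<Pi>\<^sub>M i\<in>I. borel) \<rightarrow>\<^sub>M prob_algebra (\<Pi>\<^sub>M i\<in>I. borel)"
proof (rule measurable_prob_algebra_generated[OF sets_PiM Int_stable_prod_algebra prod_algebra_sets_into_space])
  fix x
  show "prob_space (\<Pi>\<^sub>M i\<in>I. K i (x i))" using prob_kernel_borel(1)[OF K] by (intro prob_space_PiM)
  show "sets (\<Pi>\<^sub>M i\<in>I. K i (x i)) = sets (\<Pi>\<^sub>M i\<in>I. borel)"
    using prob_kernel_borel(2)[OF K] by (intro sets_PiM_cong) auto
next
  fix A :: "('i \<Rightarrow> 'b) set" assume "A \<in> prod_algebra I (\<lambda>i. borel)"
  then obtain E where A: "A = Pi\<^sub>E I E" and E: "\<And>i. i \<in> I \<Longrightarrow> E i \<in> sets borel"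
    using I by (auto simp: prod_algebra_eq_finite)
  have "emeasure (\<Pi>\<^sub>M i\<in>I. K i (x i)) A = (\<Prod>i\<in>I. emeasure (K i (x i)) (E i))" for x
    unfolding A using I E prob_kernel_borel[OF K] by (intro emeasure_PiM_prob) auto
  then show "(\<lambda>x. emeasure (\<Pi>\<^sub>M i\<in>I. K i (x i)) A) \<in> borel_measurable (\<Pi>\<^sub>M i\<in>I. borel)"
    by (auto intro!: borel_measurable_prod_ennreal measurable_compose[OF measurable_component_singleton]
      measurable_emeasure_kernel[OF measurable_prob_algebraD[OF K]] E)
qed

text \<open>The outputs stay independent: the mass which the product kernel gives to a rectangle is
  a product of functions of separate inputs, so its integral under the product law
  factorizes.\<close>

lemma PiM_bind_PiM:
  fixes K :: "'i \<Rightarrow> 'a::topological_space \<Rightarrow> 'b::topological_space measure"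
  assumes I: "finite I" and K: "\<And>i. K i \<in> borel \<rightarrow>\<^sub>M prob_algebra borel"
    and N: "N \<in> space (prob_algebra borel)"
  shows "(\<Pi>\<^sub>M i\<in>I. N) \<bind> (\<lambda>x. \<Pi>\<^sub>M i\<in>I. K i (x i)) = (\<Pi>\<^sub>M i\<in>I. N \<bind> K i)"
proof -
  have pN: "prob_space N" and sN[measurable_cong]: "sets N = sets borel"
    using N by (auto simp: space_prob_algebra)
  interpret N: prob_space N by fact
  interpret NN: product_prob_space "\<lambda>_. N" I using pN by (intro product_prob_spaceI)
  have pb: "prob_space (N \<bind> K i)" and sb: "sets (N \<bind> K i) = sets borel" for i
    using prob_space_bind'[OF N K] sets_bind'[OF N K] by auto
  interpret B: product_prob_space "\<lambda>i. N \<bind> K i" I using pb by (intro product_prob_spaceI)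
  have NN: "(\<Pi>\<^sub>M i\<in>I. N) \<in> space (prob_algebra (\<Pi>\<^sub>M i\<in>I. borel))"
    using pN sN by (auto simp: space_prob_algebra intro!: prob_space_PiM sets_PiM_cong)
  note KK = PiM_kernel_measurable[OF I K]
  show ?thesis
  proof (rule B.PiM_eqI[OF I])
    show "sets ((\<Pi>\<^sub>M i\<in>I. N) \<bind> (\<lambda>x. \<Pi>\<^sub>M i\<in>I. K i (x i))) = sets (\<Pi>\<^sub>M i\<in>I. N \<bind> K i)"
      unfolding sets_bind'[OF NN KK] by (intro sets_PiM_cong) (auto simp: sb)
    fix A assume "\<And>i. i \<in> I \<Longrightarrow> A i \<in> sets (N \<bind> K i)"
    then have A: "\<And>i. i \<in> I \<Longrightarrow> A i \<in> sets borel" by (simp add: sb)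
    have "emeasure ((\<Pi>\<^sub>M i\<in>I. N) \<bind> (\<lambda>x. \<Pi>\<^sub>M i\<in>I. K i (x i))) (Pi\<^sub>E I A) =
      (\<integral>\<^sup>+x. emeasure (\<Pi>\<^sub>M i\<in>I. K i (x i)) (Pi\<^sub>E I A) \<partial>(\<Pi>\<^sub>M i\<in>I. N))"
      using I A by (intro emeasure_bind_prob_algebra[OF NN KK] sets_PiM_I_finite)
    also have "\<dots> = (\<integral>\<^sup>+x. (\<Prod>i\<in>I. emeasure (K i (x i)) (A i)) \<partial>(\<Pi>\<^sub>M i\<in>I. N))"
      using I A prob_kernel_borel[OF K] by (intro nn_integral_cong emeasure_PiM_prob) auto
    also have "\<dots> = (\<Prod>i\<in>I. \<integral>\<^sup>+x. emeasure (K i x) (A i) \<partial>N)"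
      using measurable_emeasure_kernel[OF measurable_prob_algebraD[OF K]] A I sN
      by (intro NN.product_nn_integral_prod) (auto cong: measurable_cong_sets)
    also have "\<dots> = (\<Prod>i\<in>I. emeasure (N \<bind> K i) (A i))"
      using A by (intro prod.cong refl emeasure_bind_prob_algebra[OF N K, symmetric])
    finally show "emeasure ((\<Pi>\<^sub>M i\<in>I. N) \<bind> (\<lambda>x. \<Pi>\<^sub>M i\<in>I. K i (x i))) (Pi\<^sub>E I A) =
      (\<Prod>i\<in>I. emeasure (N \<bind> K i) (A i))" .
  qed
qed

text \<open>Both sides agree on rectangles, whose indicator is the product of the coordinate
  indicators.\<close>

lemma PiM_density_prob:
  assumes I: "finite I" and M: "\<And>i. prob_space (M i)"
    and f[measurable]: "\<And>i. f i \<in> borel_measurable (M i)" and D: "\<And>i. prob_space (density (M i) (f i))"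
  shows "(\<Pi>\<^sub>M i\<in>I. density (M i) (f i)) = density (PiM I M) (\<lambda>z. \<Prod>i\<in>I. f i (z i))"
proof -
  interpret M: product_prob_space M I using M by (intro product_prob_spaceI)
  interpret D: product_prob_space "\<lambda>i. density (M i) (f i)" I using D by (intro product_prob_spaceI)
  show ?thesis
  proof (rule D.PiM_eqI[OF I, symmetric])
    show "sets (density (PiM I M) (\<lambda>z. \<Prod>i\<in>I. f i (z i))) = sets (\<Pi>\<^sub>M i\<in>I. density (M i) (f i))"
      by (auto intro!: sets_PiM_cong)
    fix A assume A: "\<And>i. i \<in> I \<Longrightarrow> A i \<in> sets (density (M i) (f i))"
    have A': "Pi\<^sub>E I A \<in> sets (PiM I M)" using A I by (intro sets_PiM_I_finite) auto
    have "emeasure (density (PiM I M) (\<lambda>z. \<Prod>i\<in>I. f i (z i))) (Pi\<^sub>E I A) =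
      (\<integral>\<^sup>+z. (\<Prod>i\<in>I. f i (z i)) * indicator (Pi\<^sub>E I A) z \<partial>PiM I M)"
      using A' by (intro emeasure_density) auto
    also have "\<dots> = (\<integral>\<^sup>+z. (\<Prod>i\<in>I. f i (z i) * indicator (A i) (z i)) \<partial>PiM I M)"
      using I by (intro nn_integral_cong) (auto simp: prod.distrib indicator_def space_PiM PiE_iff prod_zero_iff)
    also have "\<dots> = (\<Prod>i\<in>I. \<integral>\<^sup>+z. f i z * indicator (A i) z \<partial>M i)"
      using I A by (intro M.product_nn_integral_prod) auto
    also have "\<dots> = (\<Prod>i\<in>I. emeasure (density (M i) (f i)) (A i))"
      using A by (intro prod.cong refl emeasure_density[symmetric]) auto
    finally show "emeasure (density (PiM I M) (\<lambda>z. \<Prod>i\<in>I. f i (z i))) (Pi\<^sub>E I A) =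
      (\<Prod>i\<in>I. emeasure (density (M i) (f i)) (A i))" .
  qed
qed

section \<open>Cauchy--Schwarz under a change of measure\<close>

lemma measure_density_square_le:
  fixes F :: "'a \<Rightarrow> real"
  assumes "finite_measure M" and [measurable]: "F \<in> borel_measurable M" "A \<in> sets M" and F0: "\<And>z. 0 \<le> F z"
    and F2: "integrable M (\<lambda>z. (F z)\<^sup>2)"
  shows "(measure (density M (\<lambda>z. ennreal (F z))) A)\<^sup>2 \<le> measure M A * (\<integral>z. (F z)\<^sup>2 \<partial>M)"
proof -
  interpret finite_measure M by fact
  define m where "m = measure (density M (\<lambda>z. ennreal (F z))) A"
  have iF: "integrable M F" using F2 by (rule square_integrable_imp_integrable[rotated]) simp
  have iFA: "integrable M (\<lambda>z. F z * indicator A z)" by (rule integrable_real_mult_indicator[OF _ iF]) simp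
  have "emeasure (density M (\<lambda>z. ennreal (F z))) A = (\<integral>\<^sup>+z. ennreal (F z * indicator A z) \<partial>M)"
    by (subst emeasure_density) (auto simp: indicator_def intro!: nn_integral_cong)
  also have "\<dots> = ennreal (\<integral>z. F z * indicator A z \<partial>M)"
    using F0 by (intro nn_integral_eq_integral iFA) auto
  finally have m: "m = (\<integral>z. F z * indicator A z \<partial>M)"
    using F0 by (simp add: m_def measure_def)
  have iA: "integrable M (\<lambda>z. t\<^sup>2 * indicator A z)" for t :: real
    by (intro integrable_mult_right integrable_real_indicator) (auto simp: emeasure_eq_measure)
  \<comment> \<open>Cauchy--Schwarz for \<open>F\<close> and the indicator of \<open>A\<close>, as a
    quadratic inequality in \<open>t\<close>. If \<open>A\<close> has positive mass, the best choice
    is \<open>t = m / measure M A\<close>.\<close>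
  have le: "2 * t * m \<le> t\<^sup>2 * measure M A + (\<integral>z. (F z)\<^sup>2 \<partial>M)" for t
  proof -
    have "(\<integral>z. 2 * t * (F z * indicator A z) \<partial>M) \<le> (\<integral>z. t\<^sup>2 * indicator A z + (F z)\<^sup>2 \<partial>M)"
    proof (rule integral_mono)
      fix z show "2 * t * (F z * indicator A z) \<le> t\<^sup>2 * indicator A z + (F z)\<^sup>2"
        using sum_squares_bound[of t "F z"] by (auto simp: indicator_def)
      show "integrable M (\<lambda>z. t\<^sup>2 * indicator A z + (F z)\<^sup>2)"
        using iA F2 by (intro Bochner_Integration.integrable_add)
    qed (use iFA in auto)
    also have "\<dots> = (\<integral>z. t\<^sup>2 * indicator A z \<partial>M) + (\<integral>z. (F z)\<^sup>2 \<partial>M)"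
      using iA F2 by (rule Bochner_Integration.integral_add)
    finally show ?thesis by (simp add: m)
  qed
  have E0: "0 \<le> (\<integral>z. (F z)\<^sup>2 \<partial>M)" by simp
  show ?thesis
  proof (cases "measure M A = 0")
    case True
    have "m \<le> 0"
    proof (rule ccontr)
      assume "\<not> m \<le> 0"
      \<comment> \<open>For this \<open>t\<close> the inequality would bound twice the second moment
        plus two by the second moment itself.\<close>
      then show False
        using le[of "((\<integral>z. (F z)\<^sup>2 \<partial>M) + 1) / m"] E0 True by simp
    qed
    moreover have "m \<ge> 0" by (simp add: m_def)
    ultimately have "m = 0" by simp
    then show ?thesis using True by (simp add: m_def)
  next
    case False
    then have "measure M A > 0" by (simp add: zero_less_measure_iff)
    then show ?thesis using le[of "m / measure M A"] by (simp add: field_simps power2_eq_square m_def)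
  qed
qed

text \<open>Second moments of likelihood ratios multiply over independent coordinates. Each equals
  one plus the chi-square divergence, hence is at most its exponential. The exponential turns the
  product over samples into a sum, which can later be exchanged with the sum over signal
  coordinates.\<close>

lemma PiM_density_square_le:
  fixes f :: "'i \<Rightarrow> 'a \<Rightarrow> real"
  assumes I: "finite I" and M: "\<And>i. prob_space (M i)"
    and f[measurable]: "\<And>i. f i \<in> borel_measurable (M i)" and f0: "\<And>i z. 0 \<le> f i z" and fk: "\<And>i z. f i z \<le> k"
    and D: "\<And>i. prob_space (density (M i) (\<lambda>z. ennreal (f i z)))" and A: "A \<in> sets (PiM I M)"
  shows "(measure (\<Pi>\<^sub>M i\<in>I. density (M i) (\<lambda>z. ennreal (f i z))) A)\<^sup>2 \<le>
    measure (PiM I M) A * exp (\<Sum>i\<in>I. \<integral>z. (f i z - 1)\<^sup>2 \<partial>M i)"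
proof -
  let ?F = "\<lambda>z. \<Prod>i\<in>I. f i (z i)"
  have bd: "integrable (M i) (\<lambda>z. (f i z)\<^sup>2)" "integrable (M i) (f i)" for i
  proof -
    interpret prob_space "M i" by fact
    have "\<bar>f i z\<bar> \<le> k" "\<bar>(f i z)\<^sup>2\<bar> \<le> k\<^sup>2" for z using f0[of i z] fk[of i z] by (auto intro!: power_mono)
    then show "integrable (M i) (\<lambda>z. (f i z)\<^sup>2)" "integrable (M i) (f i)"
      by (intro integrable_const_bound[of _ "k\<^sup>2"] integrable_const_bound[of _ k]; simp)+
  qed
  have e: "(\<integral>z. (f i z)\<^sup>2 \<partial>M i) \<le> exp (\<integral>z. (f i z - 1)\<^sup>2 \<partial>M i)" for i
  proof -
    interpret prob_space "M i" by fact
    interpret D: prob_space "density (M i) (\<lambda>z. ennreal (f i z))" by fact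
    have "1 = (\<integral>z. (1::real) \<partial>density (M i) (\<lambda>z. ennreal (f i z)))"
      using D.prob_space by simp
    also have "\<dots> = (\<integral>z. f i z \<partial>M i)" using f0 by (subst integral_density) auto
    finally have 1: "(\<integral>z. f i z \<partial>M i) = 1" ..
    have "(\<integral>z. (f i z - 1)\<^sup>2 \<partial>M i) = (\<integral>z. (f i z)\<^sup>2 - 2 * f i z + 1 \<partial>M i)"
      by (simp add: power2_eq_square algebra_simps)
    also have "\<dots> = (\<integral>z. (f i z)\<^sup>2 \<partial>M i) - 1" using bd[of i] prob_space by (simp add: 1)
    finally show ?thesis using exp_ge_add_one_self[of "\<integral>z. (f i z - 1)\<^sup>2 \<partial>M i"] by simp
  qed
  interpret M: product_prob_space M I using M by (intro product_prob_spaceI)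
  have "(\<Pi>\<^sub>M i\<in>I. density (M i) (\<lambda>z. ennreal (f i z))) = density (PiM I M) (\<lambda>z. \<Prod>i\<in>I. ennreal (f i (z i)))"
    by (rule PiM_density_prob[OF I M _ D]) auto
  also have "\<dots> = density (PiM I M) (\<lambda>z. ennreal (?F z))"
    using f0 by (simp add: prod_ennreal)
  finally have "(measure (\<Pi>\<^sub>M i\<in>I. density (M i) (\<lambda>z. ennreal (f i z))) A)\<^sup>2 =
    (measure (density (PiM I M) (\<lambda>z. ennreal (?F z))) A)\<^sup>2" by simp
  also have "\<dots> \<le> measure (PiM I M) A * (\<integral>z. (?F z)\<^sup>2 \<partial>PiM I M)"
  proof (rule measure_density_square_le[OF prob_space.finite_measure[OF prob_space_PiM[OF M]] _ A])
    show "integrable (PiM I M) (\<lambda>z. (?F z)\<^sup>2)"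
      unfolding prod_power_distrib using I bd by (intro M.product_integrable_prod) auto
  qed (use f0 I in \<open>auto intro: prod_nonneg\<close>)
  also have "(\<integral>z. (?F z)\<^sup>2 \<partial>PiM I M) = (\<Prod>i\<in>I. \<integral>z. (f i z)\<^sup>2 \<partial>M i)"
    unfolding prod_power_distrib using I bd by (intro M.product_integral_prod) auto
  also have "\<dots> \<le> (\<Prod>i\<in>I. exp (\<integral>z. (f i z - 1)\<^sup>2 \<partial>M i))"
    using e by (intro prod_mono) auto
  also have "\<dots> = exp (\<Sum>i\<in>I. \<integral>z. (f i z - 1)\<^sup>2 \<partial>M i)"
    using I by (simp add: exp_sum)
  finally show ?thesis by (simp add: mult_left_mono)
qed

section \<open>The location model\<close>

text \<open>With \<open>t = 1/2\<close> and points at distance \<open>2 * b\<close>, the curvature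
  term is \<open>c * b\<^sup>2 / 2\<close>; doubling gives the exponent. The right side is a
  multiple of a translate of \<open>p\<close>, so its integral is known without a formula for
  \<open>p\<close>. For a centred Gaussian of variance \<open>1 / c\<close> there is
  equality.\<close>

lemma curvature_density_ratio:
  fixes p :: "real \<Rightarrow> real"
  assumes cb: "curvature_bounded_above c (\<lambda>x. - ln (p x))" and p: "\<And>x. p x > 0"
  shows "(p (x - b))\<^sup>2 / p x \<le> exp (c * b\<^sup>2) * p (x - 2 * b)"
proof -
  have mid: "1/2 * x + (1 - 1/2) * (x - 2 * b) = x - b" by (simp add: field_simps)
  txt \<open>\<open>x - b\<close> is the midpoint of \<open>x\<close> and \<open>x - 2 b\<close>.\<close>
  have "- (c / 2 * (1/2) * (1 - 1/2) * (x - (x - 2 * b))\<^sup>2) \<le>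
    - ln (p (1/2 * x + (1 - 1/2) * (x - 2 * b))) - (1/2 * - ln (p x) + (1 - 1/2) * - ln (p (x - 2 * b)))"
    using bspec[OF spec[OF spec[OF cb[unfolded curvature_bounded_above_def], of x], of "x - 2 * b"], of "1/2"]
    by simp
  then have "- (c / 2 * (1/2) * (1 - 1/2) * (x - (x - 2 * b))\<^sup>2) \<le>
    - ln (p (x - b)) - (1/2 * - ln (p x) + (1 - 1/2) * - ln (p (x - 2 * b)))"
    by (simp only: mid)
  then have "2 * ln (p (x - b)) - ln (p x) \<le> c * b\<^sup>2 + ln (p (x - 2 * b))"
    by (simp add: power2_eq_square field_simps)
  then have "exp (2 * ln (p (x - b)) - ln (p x)) \<le> exp (c * b\<^sup>2 + ln (p (x - 2 * b)))" by simp
  then show ?thesis using p by (simp add: exp_add exp_diff exp_double)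
qed

text \<open>Measurability and positivity of \<open>p\<close> come from its exponential form, since a
  finite convex function on the line is continuous.\<close>

lemma noise_law_density:
  assumes "noise_law c p \<mu>"
  shows "prob_space \<mu>" "\<mu> = density lborel (\<lambda>x. ennreal (p x))" "\<And>x. p x > 0" "p \<in> borel_measurable borel"
    "sets \<mu> = sets borel"
proof -
  show "prob_space \<mu>" and d: "\<mu> = density lborel (\<lambda>x. ennreal (p x))"
    using assms by (auto simp: noise_law_def)
  then show "sets \<mu> = sets borel" by simp
  obtain \<phi> where \<phi>: "convex_on UNIV \<phi>" "\<And>x. p x = exp (- \<phi> x) * exp (- (c * x\<^sup>2 / 2))"
    using assms unfolding noise_law_def strongly_log_concave_density_def by blast
  show "p x > 0" for x by (simp add: \<phi>)
  have [measurable]: "\<phi> \<in> borel_measurable borel"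
    using convex_on_continuous[OF open_UNIV \<phi>(1)] by (intro borel_measurable_continuous_onI)
  show "p \<in> borel_measurable borel" unfolding \<phi>(2) by measurable
qed

text \<open>Translation invariance of Lebesgue measure moves the shift into the density; as
  \<open>p\<close> vanishes nowhere, the result can be expressed relative to \<mu>.\<close>

lemma shift_density:
  assumes "noise_law c p \<mu>"
  shows "distr \<mu> borel (\<lambda>x. x + b) = density \<mu> (\<lambda>x. ennreal (p (x - b) / p x))"
proof -
  note d = noise_law_density[OF assms] note [measurable] = d(4)
  have "distr \<mu> borel (\<lambda>x. x + b) = distr (density lborel (\<lambda>x. ennreal (p ((x + b) - b)))) borel (\<lambda>x. x + b)"
    by (simp add: d(2))
  also have "\<dots> = density (distr lborel borel (\<lambda>x. x + b)) (\<lambda>x. ennreal (p (x - b)))"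
    by (subst density_distr) (auto simp add: measurable_lborel1)
  also have "distr lborel borel (\<lambda>x. x + b) = lborel"
    using lborel_distr_plus[of b] by (simp add: add.commute[of _ b])
  also have "density lborel (\<lambda>x. ennreal (p (x - b))) = density \<mu> (\<lambda>x. ennreal (p (x - b) / p x))"
    unfolding d(2) using less_imp_le[OF d(3)] d(3)
    by (subst density_density_eq) (auto simp: ennreal_mult[symmetric] less_imp_neq[OF d(3), symmetric] intro!: density_cong)
  finally show ?thesis .
qed

text \<open>The integrand against Lebesgue measure is bounded by a multiple of a translate of
  \<open>p\<close>, which has mass one. The bound is obtained for the nonnegative integral first, so
  that integrability follows from it.\<close>

lemma shift_chi_square:
  assumes nl: "noise_law c p \<mu>" and cb: "curvature_bounded_above c' (\<lambda>x. - ln (p x))"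
  shows "integrable \<mu> (\<lambda>x. (p (x - b) / p x)\<^sup>2)" "(\<integral>x. (p (x - b) / p x)\<^sup>2 \<partial>\<mu>) \<le> exp (c' * b\<^sup>2)"
proof -
  note d = noise_law_density[OF nl] note [measurable] = d(4)
  note pos = d(3) note [simp] = less_imp_le[OF d(3)] less_imp_neq[OF d(3), symmetric]
  have p1: "(\<integral>\<^sup>+x. ennreal (p x) \<partial>lborel) = 1"
    using prob_space.emeasure_space_1[OF d(1)] by (simp add: d(2) emeasure_density)
  have "(\<integral>\<^sup>+x. ennreal ((p (x - b) / p x)\<^sup>2) \<partial>\<mu>) = (\<integral>\<^sup>+x. ennreal (p x) * ennreal ((p (x - b) / p x)\<^sup>2) \<partial>lborel)"
    unfolding d(2) by (subst nn_integral_density) auto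
  also have "\<dots> \<le> (\<integral>\<^sup>+x. ennreal (exp (c' * b\<^sup>2)) * ennreal (p (x - 2 * b)) \<partial>lborel)"
  proof (intro nn_integral_mono)
    fix x
    have "p x * (p (x - b) / p x)\<^sup>2 = (p (x - b))\<^sup>2 / p x" by (simp add: power2_eq_square)
    also have "\<dots> \<le> exp (c' * b\<^sup>2) * p (x - 2 * b)" by (rule curvature_density_ratio[OF cb pos])
    finally show "ennreal (p x) * ennreal ((p (x - b) / p x)\<^sup>2) \<le> ennreal (exp (c' * b\<^sup>2)) * ennreal (p (x - 2 * b))"
      by (simp add: ennreal_mult[symmetric] ennreal_leI)
  qed
  also have "\<dots> = ennreal (exp (c' * b\<^sup>2)) * (\<integral>\<^sup>+x. ennreal (p (x - 2 * b)) \<partial>lborel)"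
    by (rule nn_integral_cmult) measurable
  also have "(\<integral>\<^sup>+x. ennreal (p (x - 2 * b)) \<partial>lborel) = (\<integral>\<^sup>+x. ennreal (p x) \<partial>lborel)"
    using nn_integral_real_affine[of "\<lambda>x. ennreal (p x)" 1 "- 2 * b"] by simp
  finally have le: "(\<integral>\<^sup>+x. ennreal ((p (x - b) / p x)\<^sup>2) \<partial>\<mu>) \<le> ennreal (exp (c' * b\<^sup>2))"
    by (simp add: p1)
  have m: "(\<lambda>x. (p (x - b) / p x)\<^sup>2) \<in> borel_measurable \<mu>" unfolding d(2) by measurable
  show int: "integrable \<mu> (\<lambda>x. (p (x - b) / p x)\<^sup>2)"
    using m le by (intro integrableI_nonneg) (auto intro: le_less_trans)
  show "(\<integral>x. (p (x - b) / p x)\<^sup>2 \<partial>\<mu>) \<le> exp (c' * b\<^sup>2)"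
    using le int by (subst (asm) nn_integral_eq_integral) auto
qed

section \<open>Observations under the zero signal and under one-coordinate signals\<close>

lemma distr_PiM_componentwise:
  assumes I: "finite I" and M: "\<And>i. prob_space (M i)" and g[measurable]: "\<And>i. g i \<in> M i \<rightarrow>\<^sub>M M' i"
  shows "distr (PiM I M) (PiM I M') (\<lambda>x. \<lambda>i\<in>I. g i (x i)) = (\<Pi>\<^sub>M i\<in>I. distr (M i) (M' i) (g i))"
proof -
  interpret M: product_prob_space M I using M by (intro product_prob_spaceI)
  interpret D: product_prob_space "\<lambda>i. distr (M i) (M' i) (g i)" I
    using M by (intro product_prob_spaceI prob_space.prob_space_distr g)
  have m: "(\<lambda>x. \<lambda>i\<in>I. g i (x i)) \<in> PiM I M \<rightarrow>\<^sub>M PiM I M'" by measurable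
  show ?thesis
  proof (rule D.PiM_eqI[OF I])
    show "sets (distr (PiM I M) (PiM I M') (\<lambda>x. \<lambda>i\<in>I. g i (x i))) = sets (\<Pi>\<^sub>M i\<in>I. distr (M i) (M' i) (g i))"
      by (auto intro!: sets_PiM_cong)
    fix A assume "\<And>i. i \<in> I \<Longrightarrow> A i \<in> sets (distr (M i) (M' i) (g i))"
    then have A: "\<And>i. i \<in> I \<Longrightarrow> A i \<in> sets (M' i)" by simp
    have "emeasure (distr (PiM I M) (PiM I M') (\<lambda>x. \<lambda>i\<in>I. g i (x i))) (Pi\<^sub>E I A) =
      emeasure (PiM I M) ((\<lambda>x. \<lambda>i\<in>I. g i (x i)) -` Pi\<^sub>E I A \<inter> space (PiM I M))"
      using I A by (intro emeasure_distr[OF m] sets_PiM_I_finite)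
    also have "(\<lambda>x. \<lambda>i\<in>I. g i (x i)) -` Pi\<^sub>E I A \<inter> space (PiM I M) = Pi\<^sub>E I (\<lambda>i. g i -` A i \<inter> space (M i))"
      by (auto simp: space_PiM PiE_iff)
    also have "emeasure (PiM I M) \<dots> = (\<Prod>i\<in>I. emeasure (M i) (g i -` A i \<inter> space (M i)))"
      using I A g by (intro M.emeasure_PiM) (auto intro: measurable_sets)
    also have "\<dots> = (\<Prod>i\<in>I. emeasure (distr (M i) (M' i) (g i)) (A i))"
      using A by (intro prod.cong refl emeasure_distr[symmetric] g)
    finally show "emeasure (distr (PiM I M) (PiM I M') (\<lambda>x. \<lambda>i\<in>I. g i (x i))) (Pi\<^sub>E I A) =
      (\<Prod>i\<in>I. emeasure (distr (M i) (M' i) (g i)) (A i))" .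
  qed
qed

lemma scaled_vec_lambda_measurable:
  assumes "sets \<mu> = sets borel"
  shows "(\<lambda>\<xi>. \<theta> + \<sigma> *\<^sub>R vec_lambda \<xi> :: real ^ 'd) \<in> (\<Pi>\<^sub>M j\<in>(UNIV :: 'd::finite set). \<mu>) \<rightarrow>\<^sub>M borel"
proof -
  have [measurable_cong]: "sets \<mu> = sets borel" by fact
  have "(\<lambda>\<xi>. vec_lambda \<xi> :: real ^ 'd) \<in> (\<Pi>\<^sub>M j\<in>(UNIV :: 'd set). \<mu>) \<rightarrow>\<^sub>M borel"
    by (subst borel_measurable_euclidean_space) (auto simp: Basis_vec_def inner_axis)
  then show ?thesis by simp
qed

text \<open>Adding \<open>a\<close> to coordinate \<open>j\<close> of an observation shifts one
  noise coordinate by \<open>a / \<sigma>\<close> and leaves the others alone, so the product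
  density has a single nontrivial factor.\<close>

lemma observation_law_axis:
  fixes j :: "'d::finite"
  assumes nl: "noise_law c p \<mu>" and \<sigma>: "\<sigma> > 0"
  shows "observation_law \<mu> \<sigma> (axis j a :: real ^ 'd) =
    density (observation_law \<mu> \<sigma> 0) (\<lambda>x. ennreal (p (x $ j / \<sigma> - a / \<sigma>) / p (x $ j / \<sigma>)))"
proof -
  note d = noise_law_density[OF nl] note [measurable] = d(4) note [measurable_cong] = d(5)
  define N where "N = (\<Pi>\<^sub>M j\<in>(UNIV :: 'd set). \<mu>)"
  define T where "T \<xi> = (\<sigma> *\<^sub>R vec_lambda \<xi> :: real ^ 'd)" for \<xi>
  define b where "b = a / \<sigma>"
  define r where "r x = ennreal (p (x - b) / p x)" for x
  define g where "g i x = (if i = j then x + b else x)" for i x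
  define f where "f i x = (if i = j then r x else 1)" for i x
  have [measurable]: "r \<in> borel_measurable borel" unfolding r_def by measurable
  have gm[measurable]: "g i \<in> \<mu> \<rightarrow>\<^sub>M borel" for i unfolding g_def by measurable
  have [measurable]: "f i \<in> borel_measurable \<mu>" for i unfolding f_def by measurable
  have T[measurable]: "T \<in> N \<rightarrow>\<^sub>M borel"
    unfolding N_def T_def using scaled_vec_lambda_measurable[OF d(5), of 0 \<sigma>] by simp
  have T': "T \<in> PiM UNIV (\<lambda>_. borel) \<rightarrow>\<^sub>M borel"
    unfolding T_def using scaled_vec_lambda_measurable[OF refl, of 0 \<sigma>] by simp
  have eq: "distr \<mu> borel (g i) = density \<mu> (f i)" for i
  proof (cases "i = j")
    case True
    then show ?thesis using shift_density[OF nl, of b] by (simp add: g_def[abs_def] f_def[abs_def] r_def)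
  next
    case False
    then have "distr \<mu> borel (g i) = distr \<mu> \<mu> (\<lambda>x. x)" by (intro distr_cong) (auto simp: d(5) g_def)
    then show ?thesis using False by (simp add: f_def[abs_def] distr_id density_1)
  qed
  have gc: "(\<lambda>\<xi>. \<lambda>i\<in>UNIV. g i (\<xi> i)) \<in> N \<rightarrow>\<^sub>M PiM UNIV (\<lambda>_. borel)" unfolding N_def by measurable
  have "observation_law \<mu> \<sigma> (axis j a :: real ^ 'd) = distr N borel (\<lambda>\<xi>. T (\<lambda>i\<in>UNIV. g i (\<xi> i)))"
    unfolding observation_law_def N_def T_def
    by (intro distr_cong refl) (use \<sigma> in \<open>auto simp: vec_eq_iff axis_def g_def b_def field_simps\<close>)
  also have "\<dots> = distr (distr N (PiM UNIV (\<lambda>_. borel)) (\<lambda>\<xi>. \<lambda>i\<in>UNIV. g i (\<xi> i))) borel T"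
    by (subst distr_distr[OF T' gc]) (simp add: comp_def)
  also have "distr N (PiM UNIV (\<lambda>_. borel)) (\<lambda>\<xi>. \<lambda>i\<in>UNIV. g i (\<xi> i)) = (\<Pi>\<^sub>M i\<in>UNIV. density \<mu> (f i))"
    unfolding N_def eq[symmetric] by (rule distr_PiM_componentwise) (auto simp: d(1))
  also have "\<dots> = density N (\<lambda>\<xi>. \<Prod>i\<in>UNIV. f i (\<xi> i))"
    unfolding N_def by (rule PiM_density_prob) (auto simp: d(1) eq[symmetric] intro!: prob_space.prob_space_distr)
  \<comment> \<open>The surviving factor is written as a function of \<open>T \<xi>\<close>, the
    form in which a density can be pushed forward along \<open>T\<close>.\<close>
  also have "(\<lambda>\<xi>. \<Prod>i\<in>UNIV. f i (\<xi> i)) = (\<lambda>\<xi>. r (T \<xi> $ j / \<sigma>))"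
    using \<sigma> by (simp add: f_def T_def prod.delta fun_eq_iff if_distrib cong: if_cong)
  also have "distr (density N \<dots>) borel T = density (distr N borel T) (\<lambda>x. r (x $ j / \<sigma>))"
    by (subst density_distr) auto
  also have "distr N borel T = observation_law \<mu> \<sigma> 0"
    unfolding observation_law_def N_def T_def by simp
  finally show ?thesis by (simp add: r_def b_def)
qed

lemma observation_law_prob:
  assumes "noise_law c p \<mu>"
  shows "observation_law \<mu> \<sigma> (\<theta> :: real ^ 'd::finite) \<in> space (prob_algebra borel)"
  unfolding observation_law_def space_prob_algebra
  using noise_law_density(1,5)[OF assms] scaled_vec_lambda_measurable[of \<mu> \<theta> \<sigma>]
  by (auto intro!: prob_space.prob_space_distr prob_space_PiM)

text \<open>Under the zero signal the rescaled coordinates are independent with law \<mu>.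
  Independence makes centred functions of distinct coordinates orthogonal, and single-coordinate
  integrals reduce to \<mu>.\<close>

lemma observation_law_coordinate_integrals:
  fixes i j :: "'d::finite" and u :: "real \<Rightarrow> real"
  assumes nl: "noise_law c p \<mu>" and \<sigma>: "\<sigma> > 0" and u[measurable]: "u \<in> borel_measurable borel"
  shows "integrable \<mu> u \<Longrightarrow> (\<integral>y. u y \<partial>\<mu>) = 0 \<Longrightarrow> i \<noteq> j \<Longrightarrow>
      (\<integral>x. u (x $ i / \<sigma>) * u (x $ j / \<sigma>) \<partial>observation_law \<mu> \<sigma> (0 :: real ^ 'd)) = 0"
    and "integrable \<mu> u \<Longrightarrow> integrable (observation_law \<mu> \<sigma> (0 :: real ^ 'd)) (\<lambda>x. u (x $ j / \<sigma>))"
    and "(\<integral>x. u (x $ j / \<sigma>) \<partial>observation_law \<mu> \<sigma> (0 :: real ^ 'd)) = (\<integral>y. u y \<partial>\<mu>)"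
proof -
  note d = noise_law_density[OF nl] note [measurable_cong] = d(5)
  interpret product_prob_space "\<lambda>_. \<mu>" "UNIV :: 'd set" using d(1) by (intro product_prob_spaceI)
  note T = scaled_vec_lambda_measurable[OF d(5), of "0 :: real ^ 'd" \<sigma>]
  have [measurable]: "u \<in> borel_measurable \<mu>" by measurable
  have D: "distr (\<Pi>\<^sub>M j\<in>(UNIV :: 'd set). \<mu>) \<mu> (\<lambda>\<xi>. \<xi> j) = \<mu>"
    by (rule PiM_component) simp
  have m: "(\<lambda>\<xi>. \<xi> j) \<in> (\<Pi>\<^sub>M j\<in>(UNIV :: 'd set). \<mu>) \<rightarrow>\<^sub>M \<mu>" by measurable
  {
    assume "integrable \<mu> u" "(\<integral>y. u y \<partial>\<mu>) = 0" "i \<noteq> j"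
    \<comment> \<open>Padding with the constant 1 extends the two factors to a product over all
      coordinates.\<close>
    define f where "f k = (if k = i \<or> k = j then u else (\<lambda>_. 1))" for k
    have fi: "integrable \<mu> (f k)" for k using \<open>integrable \<mu> u\<close> by (simp add: f_def)
    have "(\<integral>x. u (x $ i / \<sigma>) * u (x $ j / \<sigma>) \<partial>observation_law \<mu> \<sigma> (0 :: real ^ 'd)) =
      (\<integral>\<xi>. u (\<xi> i) * u (\<xi> j) \<partial>(\<Pi>\<^sub>M j\<in>(UNIV :: 'd set). \<mu>))"
      unfolding observation_law_def using \<sigma> by (subst integral_distr[OF T]) auto
    also have "\<dots> = (\<integral>\<xi>. (\<Prod>k\<in>UNIV. f k (\<xi> k)) \<partial>(\<Pi>\<^sub>M j\<in>(UNIV :: 'd set). \<mu>))"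
    proof (intro Bochner_Integration.integral_cong refl)
      fix \<xi> :: "'d \<Rightarrow> real"
      have "(\<Prod>k\<in>UNIV. f k (\<xi> k)) = (\<Prod>k\<in>{i, j}. f k (\<xi> k))"
        by (intro prod.mono_neutral_right) (auto simp: f_def)
      then show "u (\<xi> i) * u (\<xi> j) = (\<Prod>k\<in>UNIV. f k (\<xi> k))"
        using \<open>i \<noteq> j\<close> by (simp add: f_def)
    qed
    also have "\<dots> = (\<Prod>k\<in>UNIV. \<integral>y. f k y \<partial>\<mu>)"
      by (rule product_integral_prod) (auto simp: fi)
    also have "\<dots> = 0"
      using \<open>(\<integral>y. u y \<partial>\<mu>) = 0\<close> by (auto simp: f_def intro!: prod_zero bexI[of _ j])
    finally show "(\<integral>x. u (x $ i / \<sigma>) * u (x $ j / \<sigma>) \<partial>observation_law \<mu> \<sigma> (0 :: real ^ 'd)) = 0" .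
  }
  {
    assume iu: "integrable \<mu> u"
    have "integrable (\<Pi>\<^sub>M j\<in>(UNIV :: 'd set). \<mu>) (\<lambda>\<xi>. u (\<xi> j))"
      using integrable_distr[OF m, of u] iu unfolding D by simp
    then show "integrable (observation_law \<mu> \<sigma> (0 :: real ^ 'd)) (\<lambda>x. u (x $ j / \<sigma>))"
      unfolding observation_law_def using \<sigma> by (subst integrable_distr_eq[OF T]) auto
  }
  show "(\<integral>x. u (x $ j / \<sigma>) \<partial>observation_law \<mu> \<sigma> (0 :: real ^ 'd)) = (\<integral>y. u y \<partial>\<mu>)"
  proof -
    have "(\<integral>x. u (x $ j / \<sigma>) \<partial>observation_law \<mu> \<sigma> (0 :: real ^ 'd)) =
      (\<integral>\<xi>. u (\<xi> j) \<partial>(\<Pi>\<^sub>M j\<in>(UNIV :: 'd set). \<mu>))"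
      unfolding observation_law_def using \<sigma> by (subst integral_distr[OF T]) auto
    also have "\<dots> = (\<integral>y. u y \<partial>distr (\<Pi>\<^sub>M j\<in>(UNIV :: 'd set). \<mu>) \<mu> (\<lambda>\<xi>. \<xi> j))"
      by (rule integral_distr[symmetric]) measurable
    finally show ?thesis unfolding D .
  qed
qed

section \<open>The minimax lower bound\<close>

text \<open>The shift \<open>a / \<sigma>\<close> lies in the range where \<open>L\<close> controls
  the exponential, so each \<open>l j\<close> has squared norm at most \<open>4 * L\<close>. The
  privacy factor \<open>(exp \<alpha> - 1)\<^sup>2\<close> is at most
  \<open>4 * \<alpha>\<^sup>2\<close>; the product of the two is the stated bound.\<close>

lemma private_likelihood_ratios:
  fixes K :: "real ^ 'd \<Rightarrow> 'z::topological_space measure"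
  assumes nl: "noise_law c p \<mu>" and cb: "curvature_bounded_above c' (\<lambda>x. - ln (p x))"
    and \<sigma>: "\<sigma> > 0" and a: "0 < a" "a \<le> 2 * \<sigma>" and \<alpha>: "0 < \<alpha>" "\<alpha> < 1"
    and L: "L > 0" "\<forall>x. 0 \<le> x \<and> x \<le> 2 \<longrightarrow> exp (c' * x\<^sup>2) - 1 \<le> L * x\<^sup>2"
    and K: "K \<in> borel \<rightarrow>\<^sub>M prob_algebra borel"
    and ldp: "\<And>A x x'. A \<in> sets borel \<Longrightarrow> measure (K x) A \<le> exp \<alpha> * measure (K x') A"
  obtains f :: "'d::finite \<Rightarrow> 'z \<Rightarrow> real"
  where "\<And>j. f j \<in> borel_measurable borel" "\<And>j z. 0 \<le> f j z" "\<And>j z. f j z \<le> exp \<alpha>"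
    "\<And>j. observation_law \<mu> \<sigma> (axis j a) \<bind> K = density (observation_law \<mu> \<sigma> 0 \<bind> K) (\<lambda>z. ennreal (f j z))"
    "(\<Sum>j\<in>UNIV. \<integral>z. (f j z - 1)\<^sup>2 \<partial>(observation_law \<mu> \<sigma> 0 \<bind> K)) \<le> 16 * L * \<alpha>\<^sup>2"
proof -
  note d = noise_law_density[OF nl] note [measurable] = d(4)
  interpret prob_space \<mu> by (rule d(1))
  define b where "b = a / \<sigma>"
  define r where "r y = p (y - b) / p y" for y
  define u where "u y = r y - 1" for y
  define l where "l j x = u (x $ j / \<sigma>)" for j :: 'd and x :: "real ^ 'd"
  have b: "0 \<le> b" "b \<le> 2" using a \<sigma> by (auto simp: b_def field_simps)
  have um[measurable]: "u \<in> borel_measurable borel" unfolding u_def r_def by measurable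
  have um'[measurable]: "u \<in> borel_measurable \<mu>" using um by (simp cong: measurable_cong_sets add: d(5))
  have rm[measurable]: "r \<in> borel_measurable \<mu>" unfolding r_def d(2) by measurable
  have r0: "0 \<le> r y" for y using d(3) by (simp add: r_def less_imp_le)
  note chi = shift_chi_square[OF nl cb, of b, folded r_def]
  have ir: "integrable \<mu> (\<lambda>y. r y)"
    using chi(1) by (rule square_integrable_imp_integrable[rotated]) (simp add: d(2) r_def)
  have iu: "integrable \<mu> u" unfolding u_def using ir by auto
  have r1: "(\<integral>y. r y \<partial>\<mu>) = 1"
  proof -
    interpret D: prob_space "density \<mu> (\<lambda>x. ennreal (r x))"
      unfolding r_def shift_density[OF nl, symmetric] by (rule prob_space_distr) (simp add: d(2))
    have "1 = (\<integral>y. (1::real) \<partial>density \<mu> (\<lambda>x. ennreal (r x)))"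
      using D.prob_space by simp
    also have "\<dots> = (\<integral>y. r y \<partial>\<mu>)"
      using r0 by (subst integral_density) auto
    finally show ?thesis ..
  qed
  have u0: "(\<integral>y. u y \<partial>\<mu>) = 0" unfolding u_def using ir r1 prob_space by simp
  have u2: "(\<lambda>y. (u y)\<^sup>2) = (\<lambda>y. (r y)\<^sup>2 - 2 * r y + 1)"
    by (simp add: u_def power2_eq_square algebra_simps)
  have iu2: "integrable \<mu> (\<lambda>y. (u y)\<^sup>2)" unfolding u2 using chi(1) ir by auto
  have "(\<integral>y. (u y)\<^sup>2 \<partial>\<mu>) = (\<integral>y. (r y)\<^sup>2 \<partial>\<mu>) - 1"
    unfolding u2 using chi(1) ir r1 prob_space
    by (simp add: Bochner_Integration.integral_diff Bochner_Integration.integral_add)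
  also have "\<dots> \<le> L * b\<^sup>2" using chi(2) L(2) b by fastforce
  also have "\<dots> \<le> L * 2\<^sup>2" using b L(1) by (intro mult_left_mono power_mono) auto
  finally have v: "(\<integral>y. (u y)\<^sup>2 \<partial>\<mu>) \<le> 4 * L" by simp
  note N = observation_law_prob[OF nl, of \<sigma> "0 :: real ^ 'd"]
  have le: "emeasure (K x) A \<le> ennreal (exp \<alpha>) * emeasure (K x') A" if "A \<in> sets borel" for A x x'
  proof -
    interpret x: prob_space "K x" by (rule prob_kernel_borel[OF K])
    interpret x': prob_space "K x'" by (rule prob_kernel_borel[OF K])
    show ?thesis using ldp[OF that, of x x']
      by (simp add: x.emeasure_eq_measure x'.emeasure_eq_measure ennreal_mult[symmetric] ennreal_leI)
  qed
  have lax: "observation_law \<mu> \<sigma> (axis j a :: real ^ 'd) = density (observation_law \<mu> \<sigma> 0) (\<lambda>x. ennreal (1 + l j x))" for j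
    using observation_law_axis[OF nl \<sigma>, of j a] by (simp add: l_def u_def r_def b_def)
  have lm: "l j \<in> borel_measurable borel" for j unfolding l_def by measurable
  obtain f :: "'d \<Rightarrow> 'z \<Rightarrow> real" where f: "\<And>j. f j \<in> borel_measurable borel" "\<And>j z. 0 \<le> f j z" "\<And>j z. f j z \<le> exp \<alpha>"
    "\<And>j. density (observation_law \<mu> \<sigma> 0) (\<lambda>x. ennreal (1 + l j x)) \<bind> K =
      density (observation_law \<mu> \<sigma> 0 \<bind> K) (\<lambda>z. ennreal (f j z))"
    "(\<Sum>j\<in>UNIV. \<integral>z. (f j z - 1)\<^sup>2 \<partial>(observation_law \<mu> \<sigma> 0 \<bind> K)) \<le> (exp \<alpha> - 1)\<^sup>2 * (4 * L)"
  proof (rule private_kernel_chi_square_sum[OF K _ le N, of l "4 * L"])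
    show "prob_space (density (observation_law \<mu> \<sigma> 0) (\<lambda>x. ennreal (1 + l j x)))" for j
      using observation_law_prob[OF nl, of \<sigma> "axis j a :: real ^ 'd"] by (simp add: lax space_prob_algebra)
    show "0 \<le> 1 + l j x" for j x using d(3) by (simp add: l_def u_def r_def less_imp_le)
    show "integrable (observation_law \<mu> \<sigma> 0) (\<lambda>x. (l j x)\<^sup>2)" for j
      unfolding l_def by (rule observation_law_coordinate_integrals(2)[OF nl \<sigma> _ iu2]) measurable
    show "(\<integral>x. l i x * l j x \<partial>observation_law \<mu> \<sigma> 0) = 0" if "i \<noteq> j" for i j
      unfolding l_def by (rule observation_law_coordinate_integrals(1)[OF nl \<sigma> um iu u0 that])
    show "(\<integral>x. (l j x)\<^sup>2 \<partial>observation_law \<mu> \<sigma> 0) \<le> 4 * L" for j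
      unfolding l_def using observation_law_coordinate_integrals(3)[OF nl \<sigma>, of "\<lambda>y. (u y)\<^sup>2" j] v by simp
  qed (use \<alpha> L lm in auto)
  \<comment> \<open>As \<alpha> is below 1, its square is at most \<alpha>, which gives the linear
    bound.\<close>
  have "exp \<alpha> \<le> 1 + \<alpha> + \<alpha>\<^sup>2" using \<alpha> by (intro exp_bound) auto
  also have "\<dots> \<le> 1 + 2 * \<alpha>" using \<alpha> by (simp add: power2_eq_square)
  finally have "(exp \<alpha> - 1)\<^sup>2 \<le> (2 * \<alpha>)\<^sup>2" using \<alpha> by (intro power_mono) auto
  then have "(exp \<alpha> - 1)\<^sup>2 * (4 * L) \<le> (2 * \<alpha>)\<^sup>2 * (4 * L)" using L by (intro mult_right_mono) auto
  also have "\<dots> = 16 * L * \<alpha>\<^sup>2" by (simp add: power2_eq_square)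
  finally have "(\<Sum>j\<in>UNIV. \<integral>z. (f j z - 1)\<^sup>2 \<partial>(observation_law \<mu> \<sigma> 0 \<bind> K)) \<le> 16 * L * \<alpha>\<^sup>2"
    using f(5) by (rule order_trans[rotated])
  then show ?thesis by (intro that[of f] f(1-3)) (auto simp: lax f(4))
qed

text \<open>Each \<open>x j\<close> is at least \<open>t * exp (- y j)\<close>. By convexity the sum
  of these bounds is smallest when all \<open>y j\<close> equal their average, which is at most
  \<open>ln D\<close>; then there are \<open>D\<close> terms of size at least \<open>t / D\<close>.
  Individual \<open>y j\<close> may be large.\<close>

lemma sum_ge_of_exp_products:
  fixes x y :: "'d::finite \<Rightarrow> real"
  assumes xy: "\<And>j. t \<le> x j * exp (y j)" and "t \<ge> 0"
    and y: "(\<Sum>j\<in>UNIV. y j) \<le> real CARD('d) * ln (real CARD('d))"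
  shows "t \<le> (\<Sum>j\<in>UNIV. x j)"
proof -
  define D where "D = real CARD('d)"
  have D: "D > 0" by (simp add: D_def)
  have "t / D * (1 + ln D - y j) \<le> x j" for j
  proof -
    txt \<open>The tangent to \<open>exp\<close> at \<open>- ln D\<close>, i.e. Jensen's inequality.\<close>
    have "1 + ln D - y j \<le> exp (ln D - y j)" using exp_ge_add_one_self[of "ln D - y j"] by linarith
    then have "t / D * (1 + ln D - y j) \<le> t / D * exp (ln D - y j)"
      using D \<open>t \<ge> 0\<close> by (intro mult_left_mono) auto
    also have "\<dots> = t * exp (- y j)" using D by (simp add: exp_diff exp_minus field_simps)
    also have "\<dots> \<le> x j * exp (y j) * exp (- y j)" using xy by (intro mult_right_mono) auto
    also have "\<dots> = x j" by (simp add: exp_minus)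
    finally show ?thesis .
  qed
  then have "(\<Sum>j\<in>UNIV. t / D * (1 + ln D - y j)) \<le> (\<Sum>j\<in>UNIV. x j)" by (rule sum_mono)
  also have "(\<Sum>j\<in>UNIV. t / D * (1 + ln D - y j)) = t / D * (D + D * ln D - (\<Sum>j\<in>UNIV. y j))"
    unfolding sum_distrib_left[symmetric] by (simp add: sum_subtractf D_def distrib_left)
  finally have 1: "t / D * (D + D * ln D - (\<Sum>j\<in>UNIV. y j)) \<le> (\<Sum>j\<in>UNIV. x j)" .
  have "t / D * D \<le> t / D * (D + D * ln D - (\<Sum>j\<in>UNIV. y j))"
    using D \<open>t \<ge> 0\<close> y by (intro mult_left_mono) (auto simp: D_def)
  with 1 D show ?thesis by simp
qed

section \<open>The law of the outputs and the selection risks as event probabilities\<close>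

lemma privatized_law_eq_PiM:
  assumes N: "N \<in> space (prob_algebra borel)" and K: "\<And>i. K i \<in> borel \<rightarrow>\<^sub>M prob_algebra borel"
    and KQ: "\<And>i. i \<in> {1..n} \<Longrightarrow> Q i = K i"
  shows "privatized_law n Q N = (\<Pi>\<^sub>M i\<in>{1..n}. N \<bind> K i)"
proof -
  \<comment> \<open>A product measure depends only on the factors over its index set, so
    \<open>Q\<close> may be replaced by \<open>K\<close>, which is a kernel at every index.\<close>
  have "(\<lambda>x. \<Pi>\<^sub>M i\<in>{1..n}. Q i (x i)) = (\<lambda>x. \<Pi>\<^sub>M i\<in>{1..n}. K i (x i))"
    by (intro ext PiM_cong refl) (simp add: KQ)
  then show ?thesis unfolding privatized_law_def by (simp add: PiM_bind_PiM[OF _ K N])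
qed

text \<open>The true support is empty, so every selected coordinate is an error.\<close>

lemma selection_risk_zero:
  assumes sets: "sets (privatized_law n Q (observation_law \<mu> \<sigma> 0)) = sets (\<Pi>\<^sub>M i\<in>{1..n}. borel)"
    and \<eta>: "\<eta>' \<in> separable_selectors n"
  shows "selection_risk n Q \<eta>' \<mu> \<sigma> (0 :: real ^ 'd::finite) =
    (\<Sum>j\<in>UNIV. emeasure (privatized_law n Q (observation_law \<mu> \<sigma> 0)) {z \<in> space (\<Pi>\<^sub>M i\<in>{1..n}. borel). \<eta>' z $ j = 1})"
proof -
  define P where "P = privatized_law n Q (observation_law \<mu> \<sigma> (0 :: real ^ 'd))"
  define B where "B = (\<Pi>\<^sub>M i\<in>{1..n}. (borel :: (real ^ 'd) measure))"
  have sP[measurable_cong]: "sets P = sets B" using sets by (simp add: P_def B_def)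
  have m[measurable]: "(\<lambda>z. \<eta>' z $ j) \<in> B \<rightarrow>\<^sub>M count_space {0, 1}" for j
    using \<eta> by (simp add: separable_selectors_def B_def)
  define A where "A j = {z \<in> space B. \<eta>' z $ j = 1}" for j
  have A[measurable]: "A j \<in> sets B" for j unfolding A_def by measurable
  have "selection_risk n Q \<eta>' \<mu> \<sigma> (0 :: real ^ 'd) = (\<integral>\<^sup>+z. (\<Sum>j\<in>UNIV. indicator (A j) z) \<partial>P)"
    unfolding selection_risk_def P_def[symmetric]
  proof (intro nn_integral_cong)
    fix z assume "z \<in> space P"
    then have z: "z \<in> space B" using sets_eq_imp_space_eq[OF sP] by simp
    have "\<eta>' z $ j \<in> {0, 1}" for j using measurable_space[OF m z] by simp
    then show "of_nat (hamming_loss (\<eta>' z) (support_vector (0 :: real ^ 'd))) = (\<Sum>j\<in>UNIV. indicator (A j) z)"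
      using z unfolding hamming_loss_def of_nat_sum
      by (intro sum.cong refl) (force simp: support_vector_def A_def indicator_def)
  qed
  also have "\<dots> = (\<Sum>j\<in>UNIV. emeasure P (A j))" by (subst nn_integral_sum) auto
  finally show ?thesis by (simp add: P_def A_def B_def)
qed

text \<open>Only the error at \<open>j\<close> is kept: missing the one true coordinate costs at
  least 1.\<close>

lemma selection_risk_axis_ge:
  assumes sets: "sets (privatized_law n Q (observation_law \<mu> \<sigma> (axis j a))) = sets (\<Pi>\<^sub>M i\<in>{1..n}. borel)"
    and \<eta>: "\<eta>' \<in> separable_selectors n" and "a \<noteq> 0"
  shows "emeasure (privatized_law n Q (observation_law \<mu> \<sigma> (axis j a)))
      (space (\<Pi>\<^sub>M i\<in>{1..n}. borel) - {z \<in> space (\<Pi>\<^sub>M i\<in>{1..n}. borel). \<eta>' z $ j = 1}) \<le>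
    selection_risk n Q \<eta>' \<mu> \<sigma> (axis j a :: real ^ 'd::finite)"
proof -
  define P where "P = privatized_law n Q (observation_law \<mu> \<sigma> (axis j a :: real ^ 'd))"
  define B where "B = (\<Pi>\<^sub>M i\<in>{1..n}. (borel :: (real ^ 'd) measure))"
  have sP[measurable_cong]: "sets P = sets B" using sets by (simp add: P_def B_def)
  have m[measurable]: "(\<lambda>z. \<eta>' z $ j) \<in> B \<rightarrow>\<^sub>M count_space {0, 1}"
    using \<eta> by (simp add: separable_selectors_def B_def)
  define A where "A = {z \<in> space B. \<eta>' z $ j = 1}"
  have A[measurable]: "A \<in> sets B" unfolding A_def by measurable
  have "emeasure P (space B - A) = (\<integral>\<^sup>+z. indicator (space B - A) z \<partial>P)" by simp
  also have "\<dots> \<le> selection_risk n Q \<eta>' \<mu> \<sigma> (axis j a)"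
    unfolding selection_risk_def P_def[symmetric]
  proof (intro nn_integral_mono)
    fix z
    show "indicator (space B - A) z \<le> (of_nat (hamming_loss (\<eta>' z) (support_vector (axis j a :: real ^ 'd))) :: ennreal)"
    proof (cases "z \<in> space B - A")
      case True
      then have "\<eta>' z $ j \<noteq> support_vector (axis j a :: real ^ 'd) $ j"
        using \<open>a \<noteq> 0\<close> by (simp add: A_def support_vector_def)
      then have "1 \<le> hamming_loss (\<eta>' z) (support_vector (axis j a :: real ^ 'd))"
        unfolding hamming_loss_def
        using member_le_sum[of j UNIV "\<lambda>j'. if \<eta>' z $ j' \<noteq> support_vector (axis j a :: real ^ 'd) $ j' then 1 else (0::nat)"]
        by simp
      then have "of_nat 1 \<le> (of_nat (hamming_loss (\<eta>' z) (support_vector (axis j a :: real ^ 'd))) :: ennreal)"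
        by (rule of_nat_mono)
      then show ?thesis using True by simp
    qed simp
  qed
  finally show ?thesis by (simp add: P_def A_def B_def)
qed

theorem corollary3p7:
  fixes \<mu> :: "real measure" and p :: "real \<Rightarrow> real"
    and c c_plus \<sigma> \<alpha> L C :: real and n s :: nat
  assumes "\<sigma> > 0" and "c > 0" and "c_plus > 0"
    and "noise_law c p \<mu>"
    and "curvature_bounded_above c_plus (\<lambda>x. - ln (p x))"
    and "CARD('d::finite) \<ge> 4" and "n \<ge> 1" and "1 \<le> s" and "s \<le> CARD('d)"
    and "0 < \<alpha>" and "\<alpha> < 1"
    and "L > 0" and "\<forall>x. 0 \<le> x \<and> x \<le> 2 \<longrightarrow> exp (c_plus * x\<^sup>2) - 1 \<le> L * x\<^sup>2"
    and "0 < C" and "C < 1"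
    and "real n * \<alpha>\<^sup>2 / (real CARD('d) * ln (real CARD('d))) \<le> C / (32 * L)"
  shows "\<forall>a. 0 < a \<and> a \<le> 2 * \<sigma> \<longrightarrow>
           (INF Q \<in> ldp_mechanisms n \<alpha>. INF \<eta>' \<in> separable_selectors n.
              SUP \<theta> \<in> (sparse_signals s a :: (real ^ 'd) set). selection_risk n Q \<eta>' \<mu> \<sigma> \<theta>)
             \<ge> ennreal (1 / 4 * (1 - C))
           \<and> 1 / 4 * (1 - C) > 0"
proof (intro allI impI conjI INF_greatest)
  show "1 / 4 * (1 - C) > 0" using \<open>C < 1\<close> by simp
next
  fix a :: real and Q :: "nat \<Rightarrow> real ^ 'd \<Rightarrow> (real ^ 'd) measure" and \<eta>' :: "(nat \<Rightarrow> real ^ 'd) \<Rightarrow> nat ^ 'd"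
  assume a: "0 < a \<and> a \<le> 2 * \<sigma>" and Q: "Q \<in> ldp_mechanisms n \<alpha>" and \<eta>: "\<eta>' \<in> separable_selectors n"
  note nl = \<open>noise_law c p \<mu>\<close>
  define R where "R = (SUP \<theta> \<in> (sparse_signals s a :: (real ^ 'd) set). selection_risk n Q \<eta>' \<mu> \<sigma> \<theta>)"
  define N where "N \<theta> = observation_law \<mu> \<sigma> (\<theta> :: real ^ 'd)" for \<theta>
  txt \<open>Mechanisms outside \<open>{1..n}\<close> are unconstrained; they are replaced by \<open>Q 1\<close>.\<close>
  define K where "K i = (if i \<in> {1..n} then Q i else Q 1)" for i
  define B where "B = (\<Pi>\<^sub>M i\<in>{1..n}. (borel :: (real ^ 'd) measure))"
  define P where "P \<theta> = privatized_law n Q (N \<theta>)" for \<theta>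
  define A where "A j = {z \<in> space B. \<eta>' z $ j = 1}" for j
  have N: "N \<theta> \<in> space (prob_algebra borel)" for \<theta>
    unfolding N_def by (rule observation_law_prob[OF nl])
  have K: "K i \<in> borel \<rightarrow>\<^sub>M prob_algebra borel"
    and ldp: "\<And>A x x'. A \<in> sets borel \<Longrightarrow> measure (K i x) A \<le> exp \<alpha> * measure (K i x') A" for i
    using Q \<open>n \<ge> 1\<close> by (auto simp: K_def ldp_mechanisms_def)
  have P: "P \<theta> = (\<Pi>\<^sub>M i\<in>{1..n}. N \<theta> \<bind> K i)" for \<theta>
    unfolding P_def by (rule privatized_law_eq_PiM[OF N K]) (simp add: K_def)
  have pb: "prob_space (N \<theta> \<bind> K i)" and sb: "sets (N \<theta> \<bind> K i) = sets borel" for \<theta> i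
    using prob_space_bind'[OF N K] sets_bind'[OF N K] by auto
  have sP: "sets (P \<theta>) = sets B" for \<theta> unfolding P B_def by (intro sets_PiM_cong) (auto simp: sb)
  have spP: "space (P \<theta>) = space B" for \<theta> using sP by (rule sets_eq_imp_space_eq)
  have pP: "prob_space (P \<theta>)" for \<theta> unfolding P by (intro prob_space_PiM pb)
  have m: "(\<lambda>z. \<eta>' z $ j) \<in> B \<rightarrow>\<^sub>M count_space {0, 1}" for j
    using \<eta> by (simp add: separable_selectors_def B_def)
  have A: "A j \<in> sets B" for j
    using measurable_sets[OF m, of "{1}" j] by (simp add: A_def vimage_def Int_def conj_commute)
  have "\<forall>i. \<exists>f :: 'd \<Rightarrow> real ^ 'd \<Rightarrow> real. (\<forall>j. f j \<in> borel_measurable borel) \<and> (\<forall>j z. 0 \<le> f j z) \<and>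
    (\<forall>j z. f j z \<le> exp \<alpha>) \<and> (\<forall>j. N (axis j a) \<bind> K i = density (N 0 \<bind> K i) (\<lambda>z. ennreal (f j z))) \<and>
    (\<Sum>j\<in>UNIV. \<integral>z. (f j z - 1)\<^sup>2 \<partial>(N 0 \<bind> K i)) \<le> 16 * L * \<alpha>\<^sup>2" (is "\<forall>i. \<exists>f. ?P i f")
  proof
    fix i
    have "0 < a" "a \<le> 2 * \<sigma>" using a by auto
    from private_likelihood_ratios[OF nl assms(5,1) this assms(10-13) K[of i] ldp[of _ i]]
    obtain f :: "'d \<Rightarrow> real ^ 'd \<Rightarrow> real" where "\<And>j. f j \<in> borel_measurable borel" "\<And>j z. 0 \<le> f j z"
      "\<And>j z. f j z \<le> exp \<alpha>" "\<And>j. N (axis j a) \<bind> K i = density (N 0 \<bind> K i) (\<lambda>z. ennreal (f j z))"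
      "(\<Sum>j\<in>UNIV. \<integral>z. (f j z - 1)\<^sup>2 \<partial>(N 0 \<bind> K i)) \<le> 16 * L * \<alpha>\<^sup>2"
      unfolding N_def by blast
    then show "\<exists>f. ?P i f" by blast
  qed
  from choice[OF this] obtain f :: "nat \<Rightarrow> 'd \<Rightarrow> real ^ 'd \<Rightarrow> real" where
    fm: "\<And>i j. f i j \<in> borel_measurable borel" and f0: "\<And>i j z. 0 \<le> f i j z" and f1: "\<And>i j z. f i j z \<le> exp \<alpha>"
    and fd: "\<And>i j. N (axis j a) \<bind> K i = density (N 0 \<bind> K i) (\<lambda>z. ennreal (f i j z))"
    and fs: "\<And>i. (\<Sum>j\<in>UNIV. \<integral>z. (f i j z - 1)\<^sup>2 \<partial>(N 0 \<bind> K i)) \<le> 16 * L * \<alpha>\<^sup>2"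
    by blast
  define x where "x j = measure (P 0) (A j)" for j
  define y where "y j = (\<Sum>i\<in>{1..n}. \<integral>z. (f i j z - 1)\<^sup>2 \<partial>(N 0 \<bind> K i))" for j
  have xy: "(measure (P (axis j a)) (A j))\<^sup>2 \<le> x j * exp (y j)" for j
    unfolding x_def y_def P fd
  proof (rule PiM_density_square_le)
    show "f i j \<in> borel_measurable (N 0 \<bind> K i)" for i
      using fm sb by (simp cong: measurable_cong_sets)
    show "prob_space (density (N 0 \<bind> K i) (\<lambda>z. ennreal (f i j z)))" for i
      using pb fd by metis
    show "A j \<in> sets (\<Pi>\<^sub>M i\<in>{1..n}. N 0 \<bind> K i)" using A sP[of 0] unfolding P by simp
  qed (use pb f0 f1 in auto)
  \<comment> \<open>Each \<open>y j\<close> sums over samples for a fixed coordinate, whereas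
    privacy bounds the sum over coordinates for a fixed sample.\<close>
  have "(\<Sum>j\<in>UNIV. y j) = (\<Sum>i\<in>{1..n}. \<Sum>j\<in>UNIV. \<integral>z. (f i j z - 1)\<^sup>2 \<partial>(N 0 \<bind> K i))"
    unfolding y_def by (rule sum.swap)
  also have "\<dots> \<le> (\<Sum>i\<in>{1..n}. 16 * L * \<alpha>\<^sup>2)" by (intro sum_mono fs)
  also have "\<dots> = 16 * L * (real n * \<alpha>\<^sup>2)" by simp
  \<comment> \<open>Multiplying out the sample size condition leaves the factor
    \<open>C / 2\<close>, which is relaxed to 1, the budget allowed by
    \<open>sum_ge_of_exp_products\<close>.\<close>
  also have "\<dots> \<le> 16 * L * (C / (32 * L) * (real CARD('d) * ln (real CARD('d))))"
  proof (intro mult_left_mono)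
    have "0 < real CARD('d) * ln (real CARD('d))" using \<open>CARD('d) \<ge> 4\<close> by simp
    then show "real n * \<alpha>\<^sup>2 \<le> C / (32 * L) * (real CARD('d) * ln (real CARD('d)))"
      using assms(16) by (simp add: pos_divide_le_eq)
  qed (use \<open>L > 0\<close> in simp)
  also have "\<dots> = C / 2 * (real CARD('d) * ln (real CARD('d)))" using \<open>L > 0\<close> by simp
  also have "\<dots> \<le> 1 * (real CARD('d) * ln (real CARD('d)))"
    using \<open>C < 1\<close> \<open>CARD('d) \<ge> 4\<close> by (intro mult_right_mono) auto
  finally have y: "(\<Sum>j\<in>UNIV. y j) \<le> real CARD('d) * ln (real CARD('d))" by simp
  \<comment> \<open>The worst-case risk is at least \<open>1/4\<close>; the factor
    \<open>1 - C\<close> enters only when this is weakened at the end.\<close>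
  have "ennreal (1 / 4) \<le> R"
  proof (rule ccontr)
    assume "\<not> ennreal (1 / 4) \<le> R"
    then have R: "R < ennreal (1 / 4)" by simp
    have "(0 :: real ^ 'd) \<in> sparse_signals s a"
      by (auto simp: sparse_signals_def intro!: exI[of _ "{}"])
    then have "selection_risk n Q \<eta>' \<mu> \<sigma> (0 :: real ^ 'd) \<le> R" unfolding R_def by (rule SUP_upper)
    moreover have "selection_risk n Q \<eta>' \<mu> \<sigma> (0 :: real ^ 'd) = (\<Sum>j\<in>UNIV. emeasure (P 0) (A j))"
      using selection_risk_zero[OF _ \<eta>, of Q \<mu> \<sigma>] sP[of 0] by (simp add: P_def N_def A_def B_def)
    moreover have "(\<Sum>j\<in>UNIV. emeasure (P 0) (A j)) = ennreal (\<Sum>j\<in>UNIV. x j)"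
      unfolding x_def finite_measure.emeasure_eq_measure[OF prob_space.finite_measure[OF pP]]
      by (simp add: sum_ennreal)
    ultimately have "ennreal (\<Sum>j\<in>UNIV. x j) < ennreal (1 / 4)" using R by simp
    then have "(\<Sum>j\<in>UNIV. x j) < 1 / 4" by (simp add: ennreal_less_iff x_def sum_nonneg)
    \<comment> \<open>A signal with one nonzero entry is admissible because \<open>s\<close> is at
      least 1. Risk below \<open>1/4\<close> there means that \<open>j\<close> is selected with
      probability at least \<open>3/4\<close>, whose square is \<open>9/16\<close>.\<close>
    moreover have "9 / 16 \<le> x j * exp (y j)" for j
    proof -
      interpret Pj: prob_space "P (axis j a)" by (rule pP)
      have "axis j a \<in> (sparse_signals s a :: (real ^ 'd) set)"
        using \<open>1 \<le> s\<close> by (auto simp: sparse_signals_def axis_def intro!: exI[of _ "{j}"])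
      then have "selection_risk n Q \<eta>' \<mu> \<sigma> (axis j a) \<le> R" unfolding R_def by (rule SUP_upper)
      moreover have "emeasure (P (axis j a)) (space B - A j) \<le> selection_risk n Q \<eta>' \<mu> \<sigma> (axis j a)"
        using selection_risk_axis_ge[OF _ \<eta>, of Q \<mu> \<sigma> j a] sP[of "axis j a"] a
        by (simp add: P_def N_def A_def B_def)
      ultimately have "ennreal (measure (P (axis j a)) (space B - A j)) < ennreal (1 / 4)"
        using R by (simp add: Pj.emeasure_eq_measure)
      then have "measure (P (axis j a)) (space B - A j) < 1 / 4" by (simp add: ennreal_less_iff)
      then have "3 / 4 \<le> measure (P (axis j a)) (A j)"
        using Pj.prob_compl[of "A j"] A sP spP by simp
      then have "(3 / 4)\<^sup>2 \<le> (measure (P (axis j a)) (A j))\<^sup>2" by (intro power_mono) auto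
      with xy[of j] show ?thesis by (simp add: power2_eq_square)
    qed
    \<comment> \<open>The sum just shown to be below \<open>1/4\<close> is at least
      \<open>9/16\<close>.\<close>
    then have "9 / 16 \<le> (\<Sum>j\<in>UNIV. x j)" by (rule sum_ge_of_exp_products) (use y in auto)
    ultimately show False by simp
  qed
  moreover have "ennreal (1 / 4 * (1 - C)) \<le> ennreal (1 / 4)" using \<open>0 < C\<close> by (intro ennreal_leI) simp
  ultimately show "ennreal (1 / 4 * (1 - C)) \<le>
    (SUP \<theta> \<in> (sparse_signals s a :: (real ^ 'd) set). selection_risk n Q \<eta>' \<mu> \<sigma> \<theta>)"
    unfolding R_def by (rule order_trans[rotated])
qed

end
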